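(* Let $H_0\in C^2(\mathbb{R}^d)$ be convex, coercive ($H_0(p)\to+\infty$ as $|p|\to\infty$) and superlinear ($H_0(p)/|p|\to+\infty$ as $|p|\to\infty$), let $V:\mathbb{T}^d\to\mathbb{R}$ be Lipschitz continuous and semiconcave, let $g:\mathbb{T}^d\to\mathbb{R}$ be Lipschitz continuous and semiconcave, and set $H(x,p)=H_0(p)-V(x)$. Let $u$ be the viscosity solution of $$-\partial_tu+H(x,Du)=0\ \text{ in }\mathbb{T}^d\times(0,T),\qquad u(\cdot,T)=g\ \text{ on }\mathbb{T}^d .$$ Then there exists a constant $C>0$, depending on $T,H,g$ (and not on $\Delta t$), such that for every $\Delta t>0$ with $N=T/\Delta t$ a positive integer, the solution $\{u_n^{\Delta t}\}_{n=0}^N$ of the time-discrete semi-Lagrangian scheme $$u^{\Delta t}_n(x)=\inf_{\alpha\in\mathbb{R}^d}\big\{u^{\Delta t}_{n+1}(x-\alpha\Delta t)+\Delta t\,(L(\alpha)+V(x))\big\},\quad x\in\mathbb{T}^d,\ n=0,\dots,N-1,\qquad u_N^{\Delta t}=g,$$ where $L$ is the Legendre transform of $H_0$, satisfies $$\sup_{n=0,\dots,N}\big\|u_n^{\Delta t}(\cdot)-u(\cdot,n\Delta t)\big\|_{L^1(\mathbb{T}^d)}\le C\,\Delta t .$$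
   Context: Fix $d\ge1$ and $T>0$. $\mathbb{T}^d=\mathbb{R}^d/\mathbb{Z}^d$ is the flat torus; functions on $\mathbb{T}^d$ are identified with $\mathbb{Z}^d$-periodic functions on $\mathbb{R}^d$. A function $u$ is semiconcave if there is $C_{conc}>0$ such that for all $x_1,x_2$ and $\lambda\in(0,1)$: $u(\lambda x_1+(1-\lambda)x_2)\ge\lambda u(x_1)+(1-\lambda)u(x_2)-\lambda(1-\lambda)C_{conc}|x_1-x_2|^2$. The Legendre transform is $L(\alpha)=\sup_{p\in\mathbb{R}^d}\{\alpha\cdot p-H_0(p)\}$. The viscosity solution of the backward problem is the function $u$ such that $v(x,s)=u(x,T-s)$ is the viscosity solution of $\partial_sv+H(x,Dv)=0$, $v(\cdot,0)=g$; equivalently it is the value function $u(x,t)=\inf_{\alpha\in L^2([t,T];\mathbb{R}^d)}\big\{\int_t^T[L(\alpha(s))+V(X(s))]\,ds+g(X(T))\big\}$ where $\dot X(s)=-\alpha(s)$ on $(t,T)$, $X(t)=x$. *)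

theory Defs
  imports "HOL-Analysis.Analysis"
begin

text \<open>Functions on the flat torus are represented by their lifts to \<open>real ^ 'd\<close>,
  periodic with respect to the lattice of integer vectors.\<close>

definition Zd_periodic :: "(real ^ 'd \<Rightarrow> 'b) \<Rightarrow> bool" where
  "Zd_periodic f \<longleftrightarrow> (\<forall>x k. (\<forall>i. k $ i \<in> \<int>) \<longrightarrow> f (x + k) = f x)"

definition torus_L1_norm :: "(real ^ 'd \<Rightarrow> real) \<Rightarrow> ennreal" where
  "torus_L1_norm f = (\<integral>\<^sup>+ x\<in>cbox 0 1. ennreal \<bar>f x\<bar> \<partial>lborel)"
  \<comment> \<open>here \<open>1\<close> is the vector with all entries 1, so \<open>cbox 0 1\<close> is the unit cube\<close>

definition semiconcave :: "(real ^ 'd \<Rightarrow> real) \<Rightarrow> bool" where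
  "semiconcave f \<longleftrightarrow> (\<exists>C>0. \<forall>x1 x2. \<forall>l\<in>{0<..<1}.
     f (l *\<^sub>R x1 + (1 - l) *\<^sub>R x2) \<ge>
       l * f x1 + (1 - l) * f x2 - l * (1 - l) * C * (norm (x1 - x2))\<^sup>2)"

definition C2_function :: "(real ^ 'd \<Rightarrow> real) \<Rightarrow> bool" where
  "C2_function f \<longleftrightarrow> (\<exists>(G :: real ^ 'd \<Rightarrow> real ^ 'd) (A :: real ^ 'd \<Rightarrow> real ^ 'd ^ 'd).
     (\<forall>x. (f has_derivative (\<lambda>h. G x \<bullet> h)) (at x)) \<and>
     (\<forall>x. (G has_derivative (\<lambda>h. A x *v h)) (at x)) \<and>
     continuous_on UNIV A)"

definition coercive :: "(real ^ 'd \<Rightarrow> real) \<Rightarrow> bool" where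
  "coercive f \<longleftrightarrow> filterlim f at_top at_infinity"

definition superlinear :: "(real ^ 'd \<Rightarrow> real) \<Rightarrow> bool" where
  "superlinear f \<longleftrightarrow> filterlim (\<lambda>p. f p / norm p) at_top at_infinity"

text \<open>For a continuous superlinear \<open>H0\<close> the supremum is finite, so that the real-valued
  supremum is the Legendre transform.\<close>

definition legendre :: "(real ^ 'd \<Rightarrow> real) \<Rightarrow> real ^ 'd \<Rightarrow> real" where
  "legendre H0 a = (SUP p. a \<bullet> p - H0 p)"

text \<open>\<open>C1_test T \<phi> \<phi>t D\<phi>\<close>: the function \<open>\<phi>\<close> is continuously differentiable on the open strip
  \<open>UNIV \<times> {0<..<T}\<close>, with time derivative \<open>\<phi>t\<close> and spatial gradient \<open>D\<phi>\<close> there.\<close>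

definition C1_test ::
  "real \<Rightarrow> (real ^ 'd \<Rightarrow> real \<Rightarrow> real) \<Rightarrow> (real ^ 'd \<Rightarrow> real \<Rightarrow> real) \<Rightarrow>
    (real ^ 'd \<Rightarrow> real \<Rightarrow> real ^ 'd) \<Rightarrow> bool" where
  "C1_test T \<phi> \<phi>t D\<phi> \<longleftrightarrow>
     (\<forall>x. \<forall>s\<in>{0<..<T}.
        ((\<lambda>(y, r). \<phi> y r) has_derivative (\<lambda>(h, k). D\<phi> x s \<bullet> h + \<phi>t x s * k)) (at (x, s))) \<and>
     continuous_on (UNIV \<times> {0<..<T}) (\<lambda>(x, s). \<phi>t x s) \<and>
     continuous_on (UNIV \<times> {0<..<T}) (\<lambda>(x, s). D\<phi> x s)"

text \<open>Viscosity sub- and supersolutions of \<open>\<partial>\<^sub>s v + H(x, Dv) = 0\<close> for times in \<open>{0<..<T}\<close>.\<close>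

definition viscosity_subsolution ::
  "(real ^ 'd \<Rightarrow> real ^ 'd \<Rightarrow> real) \<Rightarrow> real \<Rightarrow> (real ^ 'd \<Rightarrow> real \<Rightarrow> real) \<Rightarrow> bool" where
  "viscosity_subsolution H T v \<longleftrightarrow>
     (\<forall>\<phi> \<phi>t D\<phi>. C1_test T \<phi> \<phi>t D\<phi> \<longrightarrow>
       (\<forall>x. \<forall>s\<in>{0<..<T}.
          (\<forall>\<^sub>F (y, r) in nhds (x, s). v y r - \<phi> y r \<le> v x s - \<phi> x s) \<longrightarrow>
          \<phi>t x s + H x (D\<phi> x s) \<le> 0))"

definition viscosity_supersolution ::
  "(real ^ 'd \<Rightarrow> real ^ 'd \<Rightarrow> real) \<Rightarrow> real \<Rightarrow> (real ^ 'd \<Rightarrow> real \<Rightarrow> real) \<Rightarrow> bool" where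
  "viscosity_supersolution H T v \<longleftrightarrow>
     (\<forall>\<phi> \<phi>t D\<phi>. C1_test T \<phi> \<phi>t D\<phi> \<longrightarrow>
       (\<forall>x. \<forall>s\<in>{0<..<T}.
          (\<forall>\<^sub>F (y, r) in nhds (x, s). v y r - \<phi> y r \<ge> v x s - \<phi> x s) \<longrightarrow>
          \<phi>t x s + H x (D\<phi> x s) \<ge> 0))"

text \<open>Continuous viscosity solutions on the closed time interval; \<open>v\<close> is irrelevant for times
  outside \<open>{0..T}\<close>.\<close>

definition viscosity_solution ::
  "(real ^ 'd \<Rightarrow> real ^ 'd \<Rightarrow> real) \<Rightarrow> real \<Rightarrow> (real ^ 'd \<Rightarrow> real) \<Rightarrow>
    (real ^ 'd \<Rightarrow> real \<Rightarrow> real) \<Rightarrow> bool" where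
  "viscosity_solution H T g v \<longleftrightarrow>
     (\<forall>s\<in>{0..T}. Zd_periodic (\<lambda>x. v x s)) \<and>
     continuous_on (UNIV \<times> {0..T}) (\<lambda>(x, s). v x s) \<and>
     viscosity_subsolution H T v \<and>
     viscosity_supersolution H T v \<and>
     (\<forall>x. v x 0 = g x)"

text \<open>The terminal value problem \<open>- \<partial>\<^sub>t u + H(x, Du) = 0\<close>, \<open>u(x, T) = g(x)\<close>, is understood through
  time reversal.\<close>

definition backward_viscosity_solution ::
  "(real ^ 'd \<Rightarrow> real ^ 'd \<Rightarrow> real) \<Rightarrow> real \<Rightarrow> (real ^ 'd \<Rightarrow> real) \<Rightarrow>
    (real ^ 'd \<Rightarrow> real \<Rightarrow> real) \<Rightarrow> bool" where
  "backward_viscosity_solution H T g u \<longleftrightarrow> viscosity_solution H T g (\<lambda>x s. u x (T - s))"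

text \<open>The infimum is over a set that is bounded below whenever \<open>w (Suc n)\<close> is bounded, because
  \<open>legendre H0 a \<ge> - H0 0\<close>; no extended real values are needed.\<close>

definition semi_lagrangian_solution ::
  "(real ^ 'd \<Rightarrow> real) \<Rightarrow> (real ^ 'd \<Rightarrow> real) \<Rightarrow> (real ^ 'd \<Rightarrow> real) \<Rightarrow> real \<Rightarrow> nat \<Rightarrow>
    (nat \<Rightarrow> real ^ 'd \<Rightarrow> real) \<Rightarrow> bool" where
  "semi_lagrangian_solution H0 V g dt N w \<longleftrightarrow>
     (\<forall>n<N. \<forall>x. w n x = (INF a. w (Suc n) (x - dt *\<^sub>R a) + dt * (legendre H0 a + V x))) \<and>
     (\<forall>x. w N x = g x)"

end

theory Submission
  imports Defs
begin

text \<open>The estimate holds even in the supremum norm, and the unit cube has volume one. The Hamiltonian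
  \<open>H0(p) - V(x)\<close> is a sum of a term in \<open>p\<close> and a term in \<open>x\<close>, and a step of the scheme is a step of
  operator splitting: the Hopf--Lax operator, which solves \<open>\<partial>\<^sub>t q + H0(Dq) = 0\<close> exactly, followed by the
  exact flow \<open>q + dt V\<close> of \<open>\<partial>\<^sub>t q = V\<close>. Between two grid times the splitting is interpolated by
  \<open>z = q(x, \<tau>) + \<tau> V(x)\<close>, where \<open>\<tau>\<close> is the time elapsed in the step. Its gradient differs from that of
  \<open>q\<close> by at most \<open>\<tau> Lip(V)\<close>, and only bounded controls matter because \<open>z\<close> is Lipschitz in space,
  uniformly in the step. So \<open>z\<close> solves the equation up to an error of order \<open>dt\<close>, the functions
  \<open>z - K dt \<tau>\<close> and \<open>z + K dt \<tau>\<close> are a strict sub- and a strict supersolution, and the comparison principle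
  gives a local error \<open>K dt\<^sup>2\<close>. The scheme is monotone and commutes with constants, so that the local
  errors add up to \<open>T K dt\<close>.

  The comparison principle (\<open>comparison_on_slab\<close>) is proved by doubling the variables. What it asks of
  \<open>z\<close> is a condition on quadratic upper bounds at earlier times, which can be read off the Hopf--Lax
  formula by moving backwards along a straight characteristic (\<open>step_lower_bound\<close> and
  \<open>step_upper_bound\<close>). The second of these two uses the same comparison principle for the negated
  functions. The induction over the steps is \<open>semi_lagrangian_sup_norm_error\<close>, stated in the
  forward time of \<open>v(x, s) = u(x, T - s)\<close>.\<close>

section \<open>Periodic functions\<close>

lemma lattice_translate_into_cube:
  fixes x :: "real ^ 'd"
  obtains k :: "real ^ 'd" where "\<And>i. k $ i \<in> \<int>" and "x + k \<in> cbox 0 1"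
proof
  show "(\<chi> i. - of_int \<lfloor>x $ i\<rfloor> :: real ^ 'd) $ i \<in> \<int>" for i
    by simp
  show "x + (\<chi> i. - of_int \<lfloor>x $ i\<rfloor>) \<in> cbox 0 1"
    by (simp add: mem_box_cart) (smt (verit, best) of_int_floor_le real_of_int_floor_add_one_ge)
qed

lemma Zd_periodicD:
  assumes "Zd_periodic f" and "\<And>i. k $ i \<in> \<int>"
  shows "f (x + k) = f x"
  using assms by (simp add: Zd_periodic_def)

lemma periodic_continuous_bounded:
  fixes v :: "real ^ 'd \<Rightarrow> real \<Rightarrow> real"
  assumes per: "\<And>s. s \<in> {a..b} \<Longrightarrow> Zd_periodic (\<lambda>x. v x s)"
    and cont: "continuous_on (UNIV \<times> {a..b}) (\<lambda>(x, s). v x s)"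
  obtains B where "\<And>x s. s \<in> {a..b} \<Longrightarrow> \<bar>v x s\<bar> \<le> B" and "B \<ge> 0"
proof -
  have "continuous_on (cbox 0 1 \<times> {a..b}) (\<lambda>(x, s). v x s)"
    using cont by (rule continuous_on_subset) auto
  then have "compact ((\<lambda>(x, s). v x s) ` (cbox 0 1 \<times> {a..b}))"
    by (intro compact_continuous_image compact_Times) auto
  then obtain B where B: "B > 0" "\<forall>y \<in> (\<lambda>(x, s). v x s) ` (cbox 0 1 \<times> {a..b}). norm y \<le> B"
    using compact_imp_bounded bounded_pos by blast
  have "\<bar>v x s\<bar> \<le> B" if s: "s \<in> {a..b}" for x s
  proof -
    obtain k :: "real ^ 'd" where k: "\<And>i. k $ i \<in> \<int>" "x + k \<in> cbox 0 1"
      by (rule lattice_translate_into_cube[of x]) blast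
    have "v (x + k) s = v x s"
      using Zd_periodicD[OF per[OF s] k(1)] by simp
    moreover have "norm (v (x + k) s) \<le> B"
      using B(2) k(2) s by force
    ultimately show ?thesis
      by simp
  qed
  then show ?thesis
    using that B(1) by force
qed

lemma periodic_uniformly_continuous_in_time:
  fixes v :: "real ^ 'd \<Rightarrow> real \<Rightarrow> real"
  assumes per: "\<And>s. s \<in> {a..b} \<Longrightarrow> Zd_periodic (\<lambda>x. v x s)"
    and cont: "continuous_on (UNIV \<times> {a..b}) (\<lambda>(x, s). v x s)"
    and e: "e > 0"
  obtains d where "d > 0"
    and "\<And>x s r. \<lbrakk>s \<in> {a..b}; r \<in> {a..b}; \<bar>s - r\<bar> < d\<rbrakk> \<Longrightarrow> \<bar>v x s - v x r\<bar> < e"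
proof -
  have "continuous_on (cbox 0 1 \<times> {a..b}) (\<lambda>(x, s). v x s)"
    using cont by (rule continuous_on_subset) auto
  then have "uniformly_continuous_on (cbox 0 1 \<times> {a..b}) (\<lambda>(x, s). v x s)"
    by (intro compact_uniformly_continuous compact_Times) auto
  then obtain d where d: "d > 0"
    "\<And>p q. \<lbrakk>p \<in> cbox 0 1 \<times> {a..b}; q \<in> cbox 0 1 \<times> {a..b}; dist q p < d\<rbrakk>
      \<Longrightarrow> dist ((\<lambda>(x, s). v x s) q) ((\<lambda>(x, s). v x s) p) < e"
    using e unfolding uniformly_continuous_on_def by metis
  have "\<bar>v x s - v x r\<bar> < e" if sr: "s \<in> {a..b}" "r \<in> {a..b}" "\<bar>s - r\<bar> < d" for x s r
  proof -
    obtain k :: "real ^ 'd" where k: "\<And>i. k $ i \<in> \<int>" "x + k \<in> cbox 0 1"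
      by (rule lattice_translate_into_cube[of x]) blast
    have "dist (x + k, s) (x + k, r) < d"
      using sr by (simp add: dist_Pair_Pair dist_real_def)
    then have "dist (v (x + k) s) (v (x + k) r) < e"
      using d(2)[of "(x + k, r)" "(x + k, s)"] k(2) sr by simp
    then show ?thesis
      using Zd_periodicD[OF per[OF sr(1)] k(1)] Zd_periodicD[OF per[OF sr(2)] k(1)]
      by (simp add: dist_real_def)
  qed
  then show ?thesis
    using that d(1) by blast
qed

section \<open>Comparison by doubling of variables\<close>

text \<open>Only times in \<open>{t0..s}\<close> are constrained: optimal controls are followed backwards, so the Hopf--Lax
  formula yields information about the past, and the end of a step is then no exception.\<close>

definition past_superjet ::
  "(real ^ 'd \<Rightarrow> real \<Rightarrow> real) \<Rightarrow> real \<Rightarrow> real ^ 'd \<Rightarrow> real \<Rightarrow> real ^ 'd \<Rightarrow> real \<Rightarrow> bool" where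
  "past_superjet z t0 x s p m \<longleftrightarrow> (\<exists>\<rho>>0. \<exists>c. \<forall>y r. norm (y - x) < \<rho> \<longrightarrow> r \<in> {t0..s} \<longrightarrow>
     z y r \<le> z x s + p \<bullet> (y - x) + m * (r - s) + c * ((norm (y - x))\<^sup>2 + (r - s)\<^sup>2))"

text \<open>The test function for \<open>v\<close> in the doubling argument. The exponential is the barrier that keeps the
  maximum away from the final time; being increasing in \<open>r\<close>, it has a harmless sign in the
  supersolution inequality, and it is smooth on the whole time axis.\<close>

lemma quadratic_test_function:
  fixes x :: "real ^ 'd"
  shows "C1_test T
    (\<lambda>y r. - (n / 2) * ((x - y) \<bullet> (x - y) + (s - r)\<^sup>2) - A * exp (M * (r - t1)))
    (\<lambda>y r. n * (s - r) - A * M * exp (M * (r - t1)))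
    (\<lambda>y r. n *\<^sub>R (x - y))"
  unfolding C1_test_def
proof (intro conjI allI ballI)
  fix y :: "real ^ 'd" and r :: real
  have "((\<lambda>q. - (n / 2) * ((x - fst q) \<bullet> (x - fst q) + (s - snd q)\<^sup>2)
            - A * exp (M * (snd q - t1))) has_derivative
          (\<lambda>q. (n *\<^sub>R (x - y)) \<bullet> fst q + (n * (s - r) - A * M * exp (M * (r - t1))) * snd q))
        (at (y, r))"
    by (auto intro!: derivative_eq_intros simp: fun_eq_iff inner_commute inner_diff_right field_simps)
  then show "((\<lambda>(y, r). - (n / 2) * ((x - y) \<bullet> (x - y) + (s - r)\<^sup>2) - A * exp (M * (r - t1)))
      has_derivative
        (\<lambda>(h, k). (n *\<^sub>R (x - y)) \<bullet> h + (n * (s - r) - A * M * exp (M * (r - t1))) * k)) (at (y, r))"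
    by (simp add: case_prod_beta')
qed (auto simp: case_prod_beta' intro!: continuous_intros)

text \<open>Suppose \<open>z > v\<close> at some point. The function
  \<open>z x s - v y r - n/2 (|x - y|\<^sup>2 + (s - r)\<^sup>2) - A exp (M (r - t1))\<close> has a maximum on the set
  \<open>|x - y| \<le> 1\<close>, by periodicity. The Lipschitz bounds for \<open>z\<close> alone give \<open>n |x - y| \<le> 2 P\<close> and
  \<open>n |s - r| \<le> 2 Q\<close>; the first bounds the gradient \<open>p = n (x - y)\<close>, so that \<open>sub\<close> is only required for
  \<open>norm p \<le> 2 * P\<close>. For large \<open>n\<close> the initial inequality excludes the initial time, the barrier excludes the
  final time for \<open>r\<close>, and the two viscosity inequalities at the maximum contradict each other
  because of \<open>\<kappa>\<close>. The slab may lie anywhere in \<open>{0..T}\<close>, so that the steps of the scheme can be treated one by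
  one.\<close>

lemma comparison_on_slab:
  fixes z v :: "real ^ 'd \<Rightarrow> real \<Rightarrow> real" and F :: "real ^ 'd \<Rightarrow> real ^ 'd \<Rightarrow> real"
  assumes t: "0 \<le> t0" "t0 < t1" "t1 \<le> T"
    and zper: "\<And>s. s \<in> {t0..t1} \<Longrightarrow> Zd_periodic (\<lambda>x. z x s)"
    and vper: "\<And>s. s \<in> {t0..t1} \<Longrightarrow> Zd_periodic (\<lambda>x. v x s)"
    and vcont: "continuous_on (UNIV \<times> {t0..t1}) (\<lambda>(x, s). v x s)"
    and super: "viscosity_supersolution F T v"
    and zlipx: "\<And>x y s. s \<in> {t0..t1} \<Longrightarrow> \<bar>z x s - z y s\<bar> \<le> P * norm (x - y)"
    and zlipt: "\<And>x s r. \<lbrakk>s \<in> {t0..t1}; r \<in> {t0..t1}\<rbrakk> \<Longrightarrow> \<bar>z x s - z x r\<bar> \<le> Q * \<bar>s - r\<bar>"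
    and Flip: "\<And>x y p. \<bar>F x p - F y p\<bar> \<le> l * norm (x - y)"
    and nonneg: "P \<ge> 0" "Q \<ge> 0" "l \<ge> 0" and \<kappa>: "\<kappa> > 0"
    and sub: "\<And>x s p m. \<lbrakk>s \<in> {t0<..t1}; norm p \<le> 2 * P; past_superjet z t0 x s p m\<rbrakk>
      \<Longrightarrow> m + F x p \<le> - \<kappa>"
    and init: "\<And>x. z x t0 \<le> v x t0"
    and s_in: "s \<in> {t0..t1}"
  shows "z x s \<le> v x s"
proof -
  have zcont: "continuous_on (UNIV \<times> {t0..t1}) (\<lambda>(x, s). z x s)"
  proof -
    have "(P + Q)-lipschitz_on (UNIV \<times> {t0..t1}) (\<lambda>(x, s). z x s)"
    proof (rule lipschitz_onI)
      show "dist ((\<lambda>(x, s). z x s) p) ((\<lambda>(x, s). z x s) q) \<le> (P + Q) * dist p q"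
        if "p \<in> UNIV \<times> {t0..t1}" "q \<in> UNIV \<times> {t0..t1}" for p q :: "(real ^ 'd) \<times> real"
      proof -
        obtain x s y r where pq: "p = (x, s)" "q = (y, r)"
          by (cases p, cases q)
        have sr: "s \<in> {t0..t1}" "r \<in> {t0..t1}"
          using that pq by auto
        have "\<bar>z x s - z y r\<bar> \<le> P * norm (x - y) + Q * \<bar>s - r\<bar>"
          using zlipx[OF sr(1), of x y] zlipt[OF sr, of y] by linarith
        also have "\<dots> \<le> P * dist p q + Q * dist p q"
          using nonneg dist_fst_le[of p q] dist_snd_le[of p q]
          by (intro add_mono mult_left_mono) (auto simp: pq dist_norm)
        finally show ?thesis
          by (simp add: pq dist_real_def algebra_simps)
      qed
    qed (use nonneg in auto)
    then show ?thesis
      by (rule lipschitz_on_continuous_on)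
  qed
  obtain B1 where B1: "\<And>x s. s \<in> {t0..t1} \<Longrightarrow> \<bar>z x s\<bar> \<le> B1" "B1 \<ge> 0"
    by (rule periodic_continuous_bounded[OF zper zcont]) auto
  obtain B2 where B2: "\<And>x s. s \<in> {t0..t1} \<Longrightarrow> \<bar>v x s\<bar> \<le> B2" "B2 \<ge> 0"
    by (rule periodic_continuous_bounded[OF vper vcont]) auto
  have before_end: "z x0 s0 \<le> v x0 s0" if s0: "s0 \<in> {t0..<t1}" for x0 s0
  proof (rule ccontr)
    define \<theta> where "\<theta> = z x0 s0 - v x0 s0"
    assume "\<not> z x0 s0 \<le> v x0 s0"
    then have \<theta>: "\<theta> > 0"
      by (simp add: \<theta>_def)
    \<comment> \<open>With this \<open>A\<close> the barrier makes the doubled function negative at \<open>r = t1\<close>; the choice of \<open>M\<close> makes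
      it at most \<open>\<theta> / 2\<close> at time \<open>s0\<close>.\<close>
    define A where "A = B1 + B2 + 1"
    have A: "A > 0"
      using B1(2) B2(2) by (simp add: A_def)
    define M where "M = 2 * A / (\<theta> * (t1 - s0))"
    have M: "M > 0"
      using A \<theta> s0 by (simp add: M_def)
    have barrier: "A * exp (M * (s0 - t1)) \<le> \<theta> / 2"
    proof -
      have "M * (s0 - t1) = - (2 * A / \<theta>)"
        using \<theta> s0 by (simp add: M_def field_simps)
      then have eq: "exp (M * (s0 - t1)) = 1 / exp (2 * A / \<theta>)"
        by (simp only: exp_minus inverse_eq_divide)
      have "2 * A / \<theta> \<le> exp (2 * A / \<theta>)"
        using exp_ge_add_one_self[of "2 * A / \<theta>"] by linarith
      then show ?thesis
        unfolding eq using \<theta> A by (simp add: field_simps)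
    qed
    obtain d where d: "d > 0"
      "\<And>x s r. \<lbrakk>s \<in> {t0..t1}; r \<in> {t0..t1}; \<bar>s - r\<bar> < d\<rbrakk> \<Longrightarrow> \<bar>v x s - v x r\<bar> < \<theta> / 4"
      by (rule periodic_uniformly_continuous_in_time[OF vper vcont, of "\<theta> / 4"]) (use \<theta> in auto)
    \<comment> \<open>One summand for each smallness condition: \<open>y\<close> interior to the unit ball around \<open>x\<close>, the
      \<open>x\<close>-dependence of \<open>F\<close> below \<open>\<kappa>\<close>, and the two bounds that exclude the initial time.\<close>
    define n where "n = 1 + 2 * P + 2 * P * l / \<kappa> + 8 * (P\<^sup>2 + Q\<^sup>2) / \<theta> + 2 * Q / d"
    have parts: "0 \<le> 2 * P * l / \<kappa>" "0 \<le> 8 * (P\<^sup>2 + Q\<^sup>2) / \<theta>" "0 \<le> 2 * Q / d"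
      using nonneg \<kappa> \<theta> d(1) by auto
    have n: "n > 0" "2 * P < n"
      using parts nonneg by (auto simp: n_def)
    have n1: "l * (2 * P / n) < \<kappa>"
    proof -
      have "2 * P * l / \<kappa> < n"
        using parts nonneg by (simp add: n_def)
      then show ?thesis
        using n \<kappa> by (simp add: field_simps)
    qed
    have n2: "2 * (P\<^sup>2 + Q\<^sup>2) / n < \<theta> / 4"
    proof -
      have "8 * (P\<^sup>2 + Q\<^sup>2) / \<theta> < n"
        using parts nonneg by (simp add: n_def)
      then show ?thesis
        using n \<theta> by (simp add: field_simps)
    qed
    have n3: "2 * Q / n < d"
    proof -
      have "2 * Q / d < n"
        using parts nonneg by (simp add: n_def)
      then show ?thesis
        using n d(1) by (simp add: field_simps)
    qed
    define \<phi> where "\<phi> x s y r = - (n / 2) * ((x - y) \<bullet> (x - y) + (s - r)\<^sup>2) - A * exp (M * (r - t1))"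
      for x y :: "real ^ 'd" and s r
    define \<Phi> where "\<Phi> x y s r = z x s - v y r + \<phi> x s y r" for x y s r
    \<comment> \<open>In the coordinates \<open>(x, y - x, s, r)\<close> the lattice acts on the first component only, so \<open>x\<close> may
      be restricted to the unit cube.\<close>
    define K :: "((real ^ 'd) \<times> (real ^ 'd) \<times> real \<times> real) set"
      where "K = cbox 0 1 \<times> cball 0 1 \<times> {t0..t1} \<times> {t0..t1}"
    define \<Psi> where "\<Psi> q = \<Phi> (fst q) (fst q + fst (snd q)) (fst (snd (snd q))) (snd (snd (snd q)))" for q
    have "continuous_on K \<Psi>"
    proof -
      have "continuous_on K (\<lambda>q. (\<lambda>(x, s). z x s) (fst q, fst (snd (snd q))))"
        by (rule continuous_on_compose2[OF zcont]) (auto simp: K_def intro!: continuous_intros)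
      moreover have "continuous_on K (\<lambda>q. (\<lambda>(x, s). v x s) (fst q + fst (snd q), snd (snd (snd q))))"
        by (rule continuous_on_compose2[OF vcont]) (auto simp: K_def intro!: continuous_intros)
      ultimately show ?thesis
        unfolding \<Psi>_def \<Phi>_def \<phi>_def by (intro continuous_intros) auto
    qed
    moreover have "compact K"
      by (auto simp: K_def intro!: compact_Times)
    moreover have "K \<noteq> {}"
    proof -
      have "(0, 0, t0, t0) \<in> K"
        using t by (simp add: K_def mem_box_cart)
      then show ?thesis
        by blast
    qed
    ultimately obtain q where q: "q \<in> K" "\<forall>q'\<in>K. \<Psi> q' \<le> \<Psi> q"
      using continuous_attains_sup[of K \<Psi>] by blast
    define x where "x = fst q"
    define y where "y = fst q + fst (snd q)"
    define s where "s = fst (snd (snd q))"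
    define r where "r = snd (snd (snd q))"
    have sr: "s \<in> {t0..t1}" "r \<in> {t0..t1}" and xy1: "norm (x - y) \<le> 1"
      using q(1) by (auto simp: K_def s_def r_def x_def y_def)
    have max: "\<Phi> x' y' s' r' \<le> \<Phi> x y s r"
      if "norm (x' - y') \<le> 1" and st: "s' \<in> {t0..t1}" "r' \<in> {t0..t1}" for x' y' s' r'
    proof -
      obtain k :: "real ^ 'd" where k: "\<And>i. k $ i \<in> \<int>" "x' + k \<in> cbox 0 1"
        by (rule lattice_translate_into_cube[of x']) blast
      have "(x' + k, y' - x', s', r') \<in> K"
        using k(2) that by (simp add: K_def norm_minus_commute)
      with q(2) have "\<Psi> (x' + k, y' - x', s', r') \<le> \<Psi> q"
        by blast
      then have "\<Phi> (x' + k) (y' + k) s' r' \<le> \<Phi> x y s r"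
        by (simp add: \<Psi>_def x_def y_def s_def r_def algebra_simps)
      moreover have "\<Phi> (x' + k) (y' + k) s' r' = \<Phi> x' y' s' r'"
        using Zd_periodicD[OF zper[OF st(1)] k(1)] Zd_periodicD[OF vper[OF st(2)] k(1)]
        by (simp add: \<Phi>_def \<phi>_def)
      ultimately show ?thesis
        by simp
    qed
    have big: "\<theta> / 2 \<le> \<Phi> x y s r"
    proof -
      have "\<theta> / 2 \<le> \<Phi> x0 x0 s0 s0"
        using barrier by (simp add: \<Phi>_def \<phi>_def \<theta>_def)
      also have "\<dots> \<le> \<Phi> x y s r"
        using s0 by (intro max) auto
      finally show ?thesis .
    qed
    have upper: "\<Phi> x y s r \<le> z x s - v y r"
    proof -
      have "0 \<le> n / 2 * ((x - y) \<bullet> (x - y) + (s - r)\<^sup>2)" "0 \<le> A * exp (M * (r - t1))"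
        using n A by auto
      then show ?thesis
        by (simp add: \<Phi>_def \<phi>_def)
    qed
    have xy: "norm (x - y) \<le> 2 * P / n"
    proof -
      have "\<Phi> y y s r \<le> \<Phi> x y s r"
        using sr by (intro max) auto
      then have "n / 2 * (norm (x - y))\<^sup>2 \<le> P * norm (x - y)"
        using zlipx[OF sr(1), of x y]
        by (simp add: \<Phi>_def \<phi>_def power2_norm_eq_inner algebra_simps)
      then have "norm (x - y) * (n / 2 * norm (x - y)) \<le> norm (x - y) * P"
        by (simp add: power2_eq_square algebra_simps)
      then have "norm (x - y) = 0 \<or> n / 2 * norm (x - y) \<le> P"
        by (metis mult_le_cancel_left_pos norm_ge_zero less_eq_real_def)
      then show ?thesis
        using n nonneg by (auto simp: field_simps)
    qed
    have sr_close: "\<bar>s - r\<bar> \<le> 2 * Q / n"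
    proof -
      have "\<Phi> x y r r \<le> \<Phi> x y s r"
        using sr xy1 by (intro max) auto
      then have "n / 2 * \<bar>s - r\<bar>\<^sup>2 \<le> Q * \<bar>s - r\<bar>"
        using zlipt[OF sr, of x] by (simp add: \<Phi>_def \<phi>_def algebra_simps)
      then have "\<bar>s - r\<bar> * (n / 2 * \<bar>s - r\<bar>) \<le> \<bar>s - r\<bar> * Q"
        by (simp add: power2_eq_square algebra_simps)
      then have "\<bar>s - r\<bar> = 0 \<or> n / 2 * \<bar>s - r\<bar> \<le> Q"
        by (metis mult_le_cancel_left_pos abs_ge_zero less_eq_real_def)
      then show ?thesis
        using n nonneg by (auto simp: field_simps)
    qed
    have Pxy: "P * norm (x - y) \<le> 2 * P\<^sup>2 / n"
      using mult_left_mono[OF xy nonneg(1)] by (simp add: power2_eq_square algebra_simps)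
    have Qsr: "Q * \<bar>s - r\<bar> \<le> 2 * Q\<^sup>2 / n"
      using mult_left_mono[OF sr_close nonneg(2)] by (simp add: power2_eq_square algebra_simps)
    have PQn: "2 * P\<^sup>2 / n + 2 * Q\<^sup>2 / n < \<theta> / 4"
      using n2 by (simp add: add_divide_distrib)
    have PQ0: "0 \<le> 2 * P\<^sup>2 / n" "0 \<le> 2 * Q\<^sup>2 / n"
      using n by auto
    have t0_in: "t0 \<in> {t0..t1}"
      using t by auto
    have "s \<noteq> t0"
    proof
      assume st: "s = t0"
      have "\<bar>v y t0 - v y r\<bar> < \<theta> / 4"
        using sr sr_close n3 by (intro d(2)) (auto simp: st)
      then have "z x s - v y r < \<theta> / 2"
        using zlipx[OF t0_in, of x y] init[of y] Pxy PQn PQ0 unfolding st by linarith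
      then show False
        using big upper by linarith
    qed
    moreover have "r \<noteq> t0"
    proof
      assume rt: "r = t0"
      have "z x s - v y r < \<theta> / 2"
        using zlipx[OF t0_in, of x y] zlipt[OF sr(1) t0_in, of x] init[of y] Pxy Qsr PQn \<theta>
        unfolding rt by linarith
      then show False
        using big upper by linarith
    qed
    moreover have "r \<noteq> t1"
    proof
      assume rt: "r = t1"
      have "\<Phi> x y s r \<le> z x s - v y r - A"
        using n by (simp add: \<Phi>_def \<phi>_def rt)
      also have "\<dots> < 0"
        using B1(1)[OF sr(1), of x] B2(1)[OF sr(2), of y] by (simp add: A_def)
      finally show False
        using big \<theta> by linarith
    qed
    ultimately have inside: "s \<in> {t0<..t1}" "r \<in> {t0<..<t1}"
      using sr by auto
    define p where "p = n *\<^sub>R (x - y)"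
    have xy_lt: "norm (x - y) < 1"
      using xy n by (smt (verit) divide_less_eq_1_pos)
    have "norm p = n * norm (x - y)"
      using n by (simp add: p_def)
    then have "norm p \<le> 2 * P"
      using xy n by (simp add: field_simps)
    moreover have "past_superjet z t0 x s p (n * (s - r))"
      unfolding past_superjet_def
    proof (intro exI conjI allI impI)
      show "1 - norm (x - y) > 0"
        using xy_lt by simp
      fix x' s' assume x': "norm (x' - x) < 1 - norm (x - y)" and s': "s' \<in> {t0..s}"
      have "norm (x' - y) \<le> 1"
        using x' norm_triangle_ineq[of "x' - x" "x - y"] by simp
      then have "\<Phi> x' y s' r \<le> \<Phi> x y s r"
        using s' sr by (intro max) auto
      then have "z x' s' \<le> z x s - n / 2 * ((x - y) \<bullet> (x - y) + (s - r)\<^sup>2)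
          + n / 2 * ((x' - y) \<bullet> (x' - y) + (s' - r)\<^sup>2)"
        by (simp add: \<Phi>_def \<phi>_def)
      also have "\<dots> = z x s + p \<bullet> (x' - x) + n * (s - r) * (s' - s)
          + n / 2 * ((norm (x' - x))\<^sup>2 + (s' - s)\<^sup>2)"
        unfolding p_def power2_norm_eq_inner
        by (simp add: inner_diff_left inner_diff_right inner_commute power2_eq_square field_simps)
      finally show "z x' s' \<le> z x s + p \<bullet> (x' - x) + n * (s - r) * (s' - s)
          + n / 2 * ((norm (x' - x))\<^sup>2 + (s' - s)\<^sup>2)" .
    qed
    ultimately have subsol: "n * (s - r) + F x p \<le> - \<kappa>"
      by (rule sub[OF inside(1)])
    have "n * (s - r) - A * M * exp (M * (r - t1)) + F y p \<ge> 0"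
    proof -
      have "\<forall>\<^sub>F q in nhds (y, r). q \<in> ball x 1 \<times> {t0<..<t1}"
        using xy_lt inside(2)
        by (intro eventually_nhds_in_open open_Times) (auto simp: dist_norm)
      then have "\<forall>\<^sub>F (y', r') in nhds (y, r). v y' r' - \<phi> x s y' r' \<ge> v y r - \<phi> x s y r"
      proof (rule eventually_mono, clarify)
        fix y' r' assume y': "y' \<in> ball x 1" and r': "r' \<in> {t0<..<t1}"
        have "\<Phi> x y' s r' \<le> \<Phi> x y s r"
          using y' r' sr by (intro max) (auto simp: dist_norm)
        then show "v y' r' - \<phi> x s y' r' \<ge> v y r - \<phi> x s y r"
          by (simp add: \<Phi>_def)
      qed
      moreover have "r \<in> {0<..<T}"
        using inside(2) t by auto
      ultimately show ?thesis
        using super quadratic_test_function[of T n x s A M t1]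
        unfolding viscosity_supersolution_def \<phi>_def p_def by blast
    qed
    moreover have "A * M * exp (M * (r - t1)) > 0"
      using A M by simp
    moreover have "\<bar>F x p - F y p\<bar> < \<kappa>"
      using Flip[of x p y] mult_left_mono[OF xy nonneg(3)] n1 by linarith
    ultimately show False
      using subsol by linarith
  qed
  show ?thesis
  proof (cases "s = t1")
    case False
    then show ?thesis
      using before_end s_in by simp
  next
    case True
    have pair: "continuous_on {t0..t1} (Pair x)" "Pair x ` {t0..t1} \<subseteq> UNIV \<times> {t0..t1}"
      by (auto intro!: continuous_intros)
    have line: "continuous_on {t0..t1} (\<lambda>s. v x s - z x s)"
      using continuous_on_compose2[OF vcont pair] continuous_on_compose2[OF zcont pair]
      by (intro continuous_intros) auto
    have "closure {t0..<t1} = {t0..t1}"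
      using t by simp
    then have "v x t1 - z x t1 \<ge> 0"
      using continuous_ge_on_closure[of "{t0..<t1}" "\<lambda>s. v x s - z x s" t1 0] line before_end t
      by auto
    then show ?thesis
      using True by simp
  qed
qed


text \<open>This turns the upper bound for a viscosity solution into an instance of the comparison principle
  for supersolutions.\<close>

lemma viscosity_subsolution_uminus:
  fixes v :: "real ^ 'd \<Rightarrow> real \<Rightarrow> real"
  assumes "viscosity_subsolution H T v"
  shows "viscosity_supersolution (\<lambda>x p. - H x (- p)) T (\<lambda>x s. - v x s)"
  unfolding viscosity_supersolution_def
proof (intro allI impI ballI)
  fix \<phi> \<phi>t :: "real ^ 'd \<Rightarrow> real \<Rightarrow> real" and D\<phi> x s
  assume test: "C1_test T \<phi> \<phi>t D\<phi>" and s: "s \<in> {0<..<T}"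
    and touch: "\<forall>\<^sub>F (y, r) in nhds (x, s). - v y r - \<phi> y r \<ge> - v x s - \<phi> x s"
  have "C1_test T (\<lambda>y r. - \<phi> y r) (\<lambda>y r. - \<phi>t y r) (\<lambda>y r. - D\<phi> y r)"
    unfolding C1_test_def
  proof (intro conjI allI ballI)
    fix y r assume "r \<in> {0<..<T}"
    then have "((\<lambda>(y, r). \<phi> y r) has_derivative (\<lambda>(h, k). D\<phi> y r \<bullet> h + \<phi>t y r * k)) (at (y, r))"
      using test by (simp add: C1_test_def)
    from has_derivative_minus[OF this]
    show "((\<lambda>(y, r). - \<phi> y r) has_derivative (\<lambda>(h, k). - D\<phi> y r \<bullet> h + - \<phi>t y r * k)) (at (y, r))"
      by (simp add: case_prod_beta')
  qed (use test in \<open>auto simp: C1_test_def case_prod_beta' intro!: continuous_intros\<close>)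
  moreover have "\<forall>\<^sub>F (y, r) in nhds (x, s). v y r - - \<phi> y r \<le> v x s - - \<phi> x s"
    using touch by (rule eventually_mono) auto
  ultimately have "- \<phi>t x s + H x (- D\<phi> x s) \<le> 0"
    using assms s unfolding viscosity_subsolution_def by blast
  then show "\<phi>t x s + - H x (- D\<phi> x s) \<ge> 0"
    by simp
qed

section \<open>The Hopf--Lax operator\<close>

definition hopf_lax ::
  "('a::real_normed_vector \<Rightarrow> real) \<Rightarrow> real \<Rightarrow> ('a \<Rightarrow> real) \<Rightarrow> 'a \<Rightarrow> real" where
  "hopf_lax L \<tau> f x = (INF a. f (x - \<tau> *\<^sub>R a) + \<tau> * L a)"

lemma lipschitz_abs_diff_le:
  fixes f :: "'a::real_normed_vector \<Rightarrow> real"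
  assumes "l-lipschitz_on UNIV f"
  shows "\<bar>f x - f y\<bar> \<le> l * norm (x - y)"
  using lipschitz_onD[OF assms, of x y] by (simp add: dist_norm)

lemma hopf_lax_objective_ge:
  assumes f: "l-lipschitz_on UNIV f" and "0 \<le> \<tau>" and L: "\<And>a. l * norm a - C \<le> L a"
  shows "f x - \<tau> * C \<le> f (x - \<tau> *\<^sub>R a) + \<tau> * L a"
proof -
  have "f x - l * (\<tau> * norm a) \<le> f (x - \<tau> *\<^sub>R a)"
    using lipschitz_abs_diff_le[OF f, of x "x - \<tau> *\<^sub>R a"] \<open>0 \<le> \<tau>\<close> by (simp add: abs_le_iff)
  then show ?thesis
    using mult_left_mono[OF L[of a] \<open>0 \<le> \<tau>\<close>] by (simp add: algebra_simps)
qed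

text \<open>Convexity makes straight lines optimal and gives the semigroup inequality; superlinear growth makes
  the infimum finite for Lipschitz data and bounds the controls that nearly attain it.\<close>

locale convex_lagrangian =
  fixes L :: "'a::real_normed_vector \<Rightarrow> real"
  assumes convex: "convex_on UNIV L"
    and superlinear_growth: "\<exists>C. \<forall>a. R * norm a - C \<le> L a"
begin

lemma hopf_lax_le:
  assumes f: "l-lipschitz_on UNIV f" and "0 \<le> \<tau>"
  shows "hopf_lax L \<tau> f x \<le> f (x - \<tau> *\<^sub>R a) + \<tau> * L a"
proof -
  obtain C where "\<And>a. l * norm a - C \<le> L a"
    using superlinear_growth by blast
  then have "bdd_below (range (\<lambda>a. f (x - \<tau> *\<^sub>R a) + \<tau> * L a))"
    using hopf_lax_objective_ge[OF assms] by (intro bdd_belowI2) blast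
  then show ?thesis
    unfolding hopf_lax_def by (rule cINF_lower) simp
qed

lemma hopf_lax_greatest:
  assumes "\<And>a. c \<le> f (x - \<tau> *\<^sub>R a) + \<tau> * L a"
  shows "c \<le> hopf_lax L \<tau> f x"
  unfolding hopf_lax_def using assms by (intro cINF_greatest) auto

lemma hopf_lax_zero: "hopf_lax L 0 f x = f x"
  by (simp add: hopf_lax_def)

lemma hopf_lax_add_potential:
  assumes f: "l-lipschitz_on UNIV f" and \<tau>: "0 \<le> \<tau>"
  shows "(INF a. f (x - \<tau> *\<^sub>R a) + \<tau> * (L a + c)) = hopf_lax L \<tau> f x + \<tau> * c"
proof (rule antisym)
  have le: "hopf_lax L \<tau> f x + \<tau> * c \<le> f (x - \<tau> *\<^sub>R a) + \<tau> * (L a + c)" for a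
    using hopf_lax_le[OF assms, of x a] by (simp add: algebra_simps)
  show "hopf_lax L \<tau> f x + \<tau> * c \<le> (INF a. f (x - \<tau> *\<^sub>R a) + \<tau> * (L a + c))"
    by (rule cINF_greatest) (auto intro: le)
  have "(INF a. f (x - \<tau> *\<^sub>R a) + \<tau> * (L a + c)) - \<tau> * c \<le> hopf_lax L \<tau> f x"
  proof (rule hopf_lax_greatest)
    fix a
    have "(INF a. f (x - \<tau> *\<^sub>R a) + \<tau> * (L a + c)) \<le> f (x - \<tau> *\<^sub>R a) + \<tau> * (L a + c)"
      by (rule cINF_lower) (auto intro: bdd_belowI2 le)
    then show "(INF a. f (x - \<tau> *\<^sub>R a) + \<tau> * (L a + c)) - \<tau> * c \<le> f (x - \<tau> *\<^sub>R a) + \<tau> * L a"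
      by (simp add: algebra_simps)
  qed
  then show "(INF a. f (x - \<tau> *\<^sub>R a) + \<tau> * (L a + c)) \<le> hopf_lax L \<tau> f x + \<tau> * c"
    by simp
qed

lemma hopf_lax_lipschitz:
  assumes f: "l-lipschitz_on UNIV f" and \<tau>: "0 \<le> \<tau>"
  shows "l-lipschitz_on UNIV (hopf_lax L \<tau> f)"
proof (rule lipschitz_onI)
  have le: "hopf_lax L \<tau> f x \<le> hopf_lax L \<tau> f y + l * norm (x - y)" for x y
  proof -
    have "hopf_lax L \<tau> f x - l * norm (x - y) \<le> hopf_lax L \<tau> f y"
    proof (rule hopf_lax_greatest)
      fix a
      have "f (x - \<tau> *\<^sub>R a) \<le> f (y - \<tau> *\<^sub>R a) + l * norm (x - y)"
        using lipschitz_abs_diff_le[OF f, of "x - \<tau> *\<^sub>R a" "y - \<tau> *\<^sub>R a"] by simp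
      then show "hopf_lax L \<tau> f x - l * norm (x - y) \<le> f (y - \<tau> *\<^sub>R a) + \<tau> * L a"
        using hopf_lax_le[OF assms, of x a] by linarith
    qed
    then show ?thesis
      by simp
  qed
  show "dist (hopf_lax L \<tau> f x) (hopf_lax L \<tau> f y) \<le> l * dist x y" for x y
    using le[of x y] le[of y x] by (simp add: dist_norm norm_minus_commute abs_le_iff)
  show "0 \<le> l"
    using f by (rule lipschitz_on_nonneg)
qed

text \<open>Using \<open>a\<close> for the last \<open>\<sigma>\<close> and \<open>b\<close> before is no cheaper than using their time average throughout,
  which leads to the same foot point.\<close>

lemma hopf_lax_semigroup_le:
  assumes f: "l-lipschitz_on UNIV f" and \<sigma>: "0 \<le> \<sigma>" "\<sigma> \<le> \<tau>"
  shows "hopf_lax L \<tau> f x \<le> hopf_lax L (\<tau> - \<sigma>) f (x - \<sigma> *\<^sub>R a) + \<sigma> * L a"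
proof (cases "\<tau> = 0")
  case True
  then show ?thesis
    using \<sigma> by simp
next
  case False
  then have \<tau>: "\<tau> > 0"
    using \<sigma> by simp
  have "hopf_lax L \<tau> f x - \<sigma> * L a \<le> hopf_lax L (\<tau> - \<sigma>) f (x - \<sigma> *\<^sub>R a)"
  proof (rule hopf_lax_greatest)
    fix b
    define u where "u = \<sigma> / \<tau>"
    have u: "0 \<le> u" "u \<le> 1" "\<tau> * u = \<sigma>"
      using \<sigma> \<tau> by (auto simp: u_def)
    define c where "c = (1 - u) *\<^sub>R b + u *\<^sub>R a"
    have "\<tau> *\<^sub>R c = \<sigma> *\<^sub>R a + (\<tau> - \<sigma>) *\<^sub>R b"
      by (simp add: c_def algebra_simps u(3))
    then have c: "x - \<tau> *\<^sub>R c = x - \<sigma> *\<^sub>R a - (\<tau> - \<sigma>) *\<^sub>R b"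
      by simp
    have "L c \<le> (1 - u) * L b + u * L a"
      unfolding c_def using convex_onD[OF convex u(1,2)] by simp
    then have "\<tau> * L c \<le> \<tau> * ((1 - u) * L b + u * L a)"
      using \<tau> by simp
    also have "\<dots> = (\<tau> - \<tau> * u) * L b + \<tau> * u * L a"
      by (simp add: algebra_simps)
    finally have "\<tau> * L c \<le> (\<tau> - \<sigma>) * L b + \<sigma> * L a"
      by (simp add: u(3))
    then show "hopf_lax L \<tau> f x - \<sigma> * L a
        \<le> f (x - \<sigma> *\<^sub>R a - (\<tau> - \<sigma>) *\<^sub>R b) + (\<tau> - \<sigma>) * L b"
      using hopf_lax_le[OF f, of \<tau> x c] \<tau> c by simp
  qed
  then show ?thesis
    by simp
qed

text \<open>One unit of growth of \<open>L\<close> beyond the Lipschitz constant pays for moving away from \<open>x\<close>. The bound is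
  independent of \<open>\<tau>\<close>, \<open>x\<close> and \<open>\<epsilon>\<close>.\<close>

lemma hopf_lax_near_optimal:
  assumes f: "l-lipschitz_on UNIV f" and L: "\<And>a. (l + 1) * norm a - C \<le> L a"
    and \<epsilon>: "0 < \<epsilon>" "\<epsilon> \<le> \<tau>"
  obtains a where "norm a \<le> L 0 + C + 1"
    and "f (x - \<tau> *\<^sub>R a) + \<tau> * L a \<le> hopf_lax L \<tau> f x + \<epsilon>"
proof -
  have \<tau>: "\<tau> > 0"
    using \<epsilon> by simp
  have "\<exists>a. f (x - \<tau> *\<^sub>R a) + \<tau> * L a < hopf_lax L \<tau> f x + \<epsilon>"
  proof (rule ccontr)
    assume "\<nexists>a. f (x - \<tau> *\<^sub>R a) + \<tau> * L a < hopf_lax L \<tau> f x + \<epsilon>"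
    then have "hopf_lax L \<tau> f x + \<epsilon> \<le> hopf_lax L \<tau> f x"
      by (intro hopf_lax_greatest) (simp add: not_less)
    then show False
      using \<epsilon> by simp
  qed
  then obtain a where a: "f (x - \<tau> *\<^sub>R a) + \<tau> * L a < hopf_lax L \<tau> f x + \<epsilon>"
    by blast
  have "f x + \<tau> * (norm a - C) \<le> f (x - \<tau> *\<^sub>R a) + \<tau> * L a"
  proof -
    have "f x - l * (\<tau> * norm a) \<le> f (x - \<tau> *\<^sub>R a)"
      using lipschitz_abs_diff_le[OF f, of x "x - \<tau> *\<^sub>R a"] \<tau> by (simp add: abs_le_iff)
    then show ?thesis
      using mult_left_mono[OF L[of a], of \<tau>] \<tau> by (simp add: algebra_simps)
  qed
  also have "\<dots> \<le> f x + \<tau> * L 0 + \<tau>"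
    using a hopf_lax_le[OF f, of \<tau> x 0] \<tau> \<epsilon> by simp
  finally have "\<tau> * norm a \<le> \<tau> * (L 0 + C + 1)"
    by (simp add: algebra_simps)
  then show ?thesis
    using that a \<tau> by simp
qed

text \<open>Upwards one waits with control \<open>0\<close> for the additional time. Downwards a control is shortened: this saves
  its running cost, and the Lipschitz function \<open>f\<close> cannot make up for more than the growth of \<open>L\<close> allows.\<close>

lemma hopf_lax_time_lipschitz:
  assumes f: "l-lipschitz_on UNIV f"
  obtains c where "c \<ge> 0"
    and "\<And>\<tau> \<sigma> x. \<lbrakk>0 \<le> \<tau>; 0 \<le> \<sigma>\<rbrakk> \<Longrightarrow> \<bar>hopf_lax L \<tau> f x - hopf_lax L \<sigma> f x\<bar> \<le> c * \<bar>\<tau> - \<sigma>\<bar>"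
proof -
  obtain C where C: "\<And>a. l * norm a - C \<le> L a"
    using superlinear_growth by blast
  have ordered: "\<bar>hopf_lax L \<tau> f x - hopf_lax L \<sigma> f x\<bar> \<le> (\<bar>L 0\<bar> + \<bar>C\<bar>) * (\<tau> - \<sigma>)"
    if "0 \<le> \<sigma>" "\<sigma> \<le> \<tau>" for \<tau> \<sigma> x
  proof -
    have "hopf_lax L \<tau> f x \<le> hopf_lax L \<sigma> f x + (\<tau> - \<sigma>) * L 0"
      using hopf_lax_semigroup_le[OF f, of "\<tau> - \<sigma>" \<tau> x 0] that by simp
    moreover have "hopf_lax L \<sigma> f x - (\<tau> - \<sigma>) * C \<le> hopf_lax L \<tau> f x"
    proof (rule hopf_lax_greatest)
      fix a
      have "f (x - \<sigma> *\<^sub>R a) - (\<tau> - \<sigma>) * C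
          \<le> f (x - \<sigma> *\<^sub>R a - (\<tau> - \<sigma>) *\<^sub>R a) + (\<tau> - \<sigma>) * L a"
        using that C by (intro hopf_lax_objective_ge[OF f]) auto
      moreover have "x - \<sigma> *\<^sub>R a - (\<tau> - \<sigma>) *\<^sub>R a = x - \<tau> *\<^sub>R a"
        by (simp add: algebra_simps)
      ultimately show "hopf_lax L \<sigma> f x - (\<tau> - \<sigma>) * C \<le> f (x - \<tau> *\<^sub>R a) + \<tau> * L a"
        using hopf_lax_le[OF f that(1), of x a] by (simp add: algebra_simps)
    qed
    moreover have "(\<tau> - \<sigma>) * L 0 \<le> (\<tau> - \<sigma>) * (\<bar>L 0\<bar> + \<bar>C\<bar>)"
      "(\<tau> - \<sigma>) * C \<le> (\<tau> - \<sigma>) * (\<bar>L 0\<bar> + \<bar>C\<bar>)"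
      using that by (auto intro!: mult_left_mono)
    ultimately show ?thesis
      by (simp add: abs_le_iff mult.commute)
  qed
  have "\<bar>hopf_lax L \<tau> f x - hopf_lax L \<sigma> f x\<bar> \<le> (\<bar>L 0\<bar> + \<bar>C\<bar>) * \<bar>\<tau> - \<sigma>\<bar>"
    if "0 \<le> \<tau>" "0 \<le> \<sigma>" for \<tau> \<sigma> x
    using ordered[of \<sigma> \<tau> x] ordered[of \<tau> \<sigma> x] that by (cases "\<sigma> \<le> \<tau>") (auto simp: abs_minus_commute)
  then show ?thesis
    by (intro that[of "\<bar>L 0\<bar> + \<bar>C\<bar>"]) auto
qed

end

lemma hopf_lax_periodic:
  fixes f :: "real ^ 'd \<Rightarrow> real"
  assumes "Zd_periodic f"
  shows "Zd_periodic (hopf_lax L \<tau> f)"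
  unfolding Zd_periodic_def
proof (intro allI impI)
  fix x k :: "real ^ 'd" assume k: "\<forall>i. k $ i \<in> \<int>"
  have "f (x + k - \<tau> *\<^sub>R a) = f (x - \<tau> *\<^sub>R a)" for a
    using Zd_periodicD[OF assms, of k "x - \<tau> *\<^sub>R a"] k by (simp add: algebra_simps)
  then show "hopf_lax L \<tau> f (x + k) = hopf_lax L \<tau> f x"
    by (simp add: hopf_lax_def)
qed


section \<open>One splitting step against the viscosity solution\<close>

text \<open>The interpolated splitting step on \<open>{t0..t0 + dt}\<close>. The rate \<open>k\<close> makes it a strict sub- or
  supersolution, and \<open>e\<close> carries the error accumulated before \<open>t0\<close>.\<close>

definition splitting_profile ::
  "(real ^ 'd \<Rightarrow> real) \<Rightarrow> (real ^ 'd \<Rightarrow> real) \<Rightarrow> (real ^ 'd \<Rightarrow> real) \<Rightarrow> real \<Rightarrow> real \<Rightarrow> real \<Rightarrow>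
    real ^ 'd \<Rightarrow> real \<Rightarrow> real" where
  "splitting_profile L V f t0 k e x s =
     hopf_lax L (s - t0) f x + (s - t0) * V x + k * (s - t0) + e"

lemma nonpos_if_le_multiple_of_small:
  fixes X Y :: real
  assumes "\<sigma>0 > 0" and le: "\<And>\<sigma>. \<lbrakk>0 < \<sigma>; \<sigma> \<le> \<sigma>0\<rbrakk> \<Longrightarrow> X \<le> Y * \<sigma>"
  shows "X \<le> 0"
proof (rule field_le_epsilon)
  fix e :: real assume e: "e > 0"
  define \<sigma> where "\<sigma> = min \<sigma>0 (e / (\<bar>Y\<bar> + 1))"
  have \<sigma>: "0 < \<sigma>" "\<sigma> \<le> \<sigma>0" "\<sigma> \<le> e / (\<bar>Y\<bar> + 1)"
    using assms(1) e by (auto simp: \<sigma>_def)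
  have "X \<le> Y * \<sigma>"
    using \<sigma> by (intro le)
  also have "\<dots> \<le> (\<bar>Y\<bar> + 1) * \<sigma>"
    using \<sigma> by (intro mult_right_mono) auto
  also have "\<dots> \<le> e"
    using \<sigma>(3) by (simp add: field_simps)
  finally show "X \<le> 0 + e"
    by simp
qed

text \<open>\<open>G\<close> plays the role of the gradient of \<open>H0\<close>: the control \<open>G p\<close> is the one for which the
  Fenchel--Young inequality is an equality.\<close>

locale separable_hamiltonian = convex_lagrangian L for L :: "real ^ 'd \<Rightarrow> real" +
  fixes H0 V :: "real ^ 'd \<Rightarrow> real" and G :: "real ^ 'd \<Rightarrow> real ^ 'd" and lV :: real
  assumes fenchel_young: "a \<bullet> p - H0 p \<le> L a"
    and fenchel_equality: "L (G p) \<le> G p \<bullet> p - H0 p"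
    and V_periodic: "Zd_periodic V"
    and V_lipschitz: "lV-lipschitz_on UNIV V"
begin

lemma lV_nonneg: "0 \<le> lV"
  using V_lipschitz by (rule lipschitz_on_nonneg)

lemma V_bounded:
  obtains B where "\<And>x. \<bar>V x\<bar> \<le> B" and "B \<ge> 0"
proof -
  have "continuous_on UNIV V"
    using V_lipschitz by (rule lipschitz_on_continuous_on)
  then have cont: "continuous_on (UNIV \<times> {0..0}) (\<lambda>(x, s :: real). V x)"
    unfolding case_prod_beta' by (rule continuous_on_compose2[OF _ continuous_on_fst[OF continuous_on_id]]) simp
  obtain B where "\<And>x s. s \<in> {0..0 :: real} \<Longrightarrow> \<bar>V x\<bar> \<le> B" "B \<ge> 0"
    by (rule periodic_continuous_bounded[of 0 0 "\<lambda>x s. V x", OF V_periodic cont]) blast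
  then show ?thesis
    by (intro that[of B]) auto
qed

lemma profile_periodic:
  assumes "Zd_periodic f"
  shows "Zd_periodic (\<lambda>x. splitting_profile L V f t0 k e x s)"
  using hopf_lax_periodic[OF assms] V_periodic
  by (simp add: splitting_profile_def Zd_periodic_def)

lemma profile_space_lipschitz:
  assumes f: "l-lipschitz_on UNIV f" and s: "s \<in> {t0..t1}"
  shows "\<bar>splitting_profile L V f t0 k e x s - splitting_profile L V f t0 k e y s\<bar>
    \<le> (l + (t1 - t0) * lV) * norm (x - y)"
proof -
  have "\<bar>hopf_lax L (s - t0) f x - hopf_lax L (s - t0) f y\<bar> \<le> l * norm (x - y)"
    using s by (intro lipschitz_abs_diff_le hopf_lax_lipschitz f) simp
  moreover have "\<bar>(s - t0) * V x - (s - t0) * V y\<bar> \<le> (t1 - t0) * (lV * norm (x - y))"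
    using mult_mono[of "s - t0" "t1 - t0" "\<bar>V x - V y\<bar>" "lV * norm (x - y)"] s
      lipschitz_abs_diff_le[OF V_lipschitz, of x y]
    by (simp add: abs_mult flip: right_diff_distrib)
  ultimately have "\<bar>splitting_profile L V f t0 k e x s - splitting_profile L V f t0 k e y s\<bar>
      \<le> l * norm (x - y) + (t1 - t0) * (lV * norm (x - y))"
    unfolding splitting_profile_def by linarith
  then show ?thesis
    by (simp add: algebra_simps)
qed

lemma profile_time_lipschitz:
  assumes f: "l-lipschitz_on UNIV f"
  obtains Q where "Q \<ge> 0"
    and "\<And>x s r. \<lbrakk>s \<in> {t0..t1}; r \<in> {t0..t1}\<rbrakk> \<Longrightarrow>
      \<bar>splitting_profile L V f t0 k e x s - splitting_profile L V f t0 k e x r\<bar> \<le> Q * \<bar>s - r\<bar>"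
proof -
  obtain c where c: "c \<ge> 0"
    "\<And>\<tau> \<sigma> x. \<lbrakk>0 \<le> \<tau>; 0 \<le> \<sigma>\<rbrakk> \<Longrightarrow> \<bar>hopf_lax L \<tau> f x - hopf_lax L \<sigma> f x\<bar> \<le> c * \<bar>\<tau> - \<sigma>\<bar>"
    by (rule hopf_lax_time_lipschitz[OF f]) blast
  obtain B where B: "\<And>x. \<bar>V x\<bar> \<le> B" "B \<ge> 0"
    by (rule V_bounded) blast
  show ?thesis
  proof (rule that)
    show "c + B + \<bar>k\<bar> \<ge> 0"
      using c B by simp
    fix x s r assume sr: "s \<in> {t0..t1}" "r \<in> {t0..t1}"
    have "splitting_profile L V f t0 k e x s - splitting_profile L V f t0 k e x r
        = (hopf_lax L (s - t0) f x - hopf_lax L (r - t0) f x) + (s - r) * V x + (s - r) * k"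
      by (simp add: splitting_profile_def algebra_simps)
    also have "\<bar>\<dots>\<bar> \<le> c * \<bar>s - r\<bar> + \<bar>s - r\<bar> * B + \<bar>s - r\<bar> * \<bar>k\<bar>"
    proof -
      have "\<bar>hopf_lax L (s - t0) f x - hopf_lax L (r - t0) f x\<bar> \<le> c * \<bar>s - r\<bar>"
        using c(2)[of "s - t0" "r - t0" x] sr by simp
      moreover have "\<bar>(s - r) * V x\<bar> \<le> \<bar>s - r\<bar> * B"
        unfolding abs_mult by (intro mult_left_mono B) simp
      moreover have "\<bar>(s - r) * k\<bar> = \<bar>s - r\<bar> * \<bar>k\<bar>"
        by (rule abs_mult)
      ultimately show ?thesis
        by linarith
    qed
    finally show "\<bar>splitting_profile L V f t0 k e x s - splitting_profile L V f t0 k e x r\<bar>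
        \<le> (c + B + \<bar>k\<bar>) * \<bar>s - r\<bar>"
      by (simp add: algebra_simps)
  qed
qed

text \<open>The splitting error: the potential is evaluated at the end point \<open>x\<close> of the characteristic instead
  of along it. The factor \<open>t1 - t0\<close> is what makes the error of a step quadratic.\<close>

lemma potential_along_control:
  assumes s: "s \<in> {t0..t1}" and \<sigma>: "0 \<le> \<sigma>" "\<sigma> \<le> s - t0" and a: "norm a \<le> M"
  shows "\<bar>(s - \<sigma> - t0) * V (x - \<sigma> *\<^sub>R a) - (s - \<sigma> - t0) * V x\<bar> \<le> (t1 - t0) * lV * M * \<sigma>"
proof -
  have "\<bar>V (x - \<sigma> *\<^sub>R a) - V x\<bar> \<le> lV * (\<sigma> * norm a)"
    using lipschitz_abs_diff_le[OF V_lipschitz, of "x - \<sigma> *\<^sub>R a" x] \<sigma> by simp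
  also have "\<dots> \<le> lV * (\<sigma> * M)"
    using a \<sigma> lV_nonneg by (intro mult_left_mono) auto
  finally have "\<bar>s - \<sigma> - t0\<bar> * \<bar>V (x - \<sigma> *\<^sub>R a) - V x\<bar> \<le> (t1 - t0) * (lV * (\<sigma> * M))"
    using s \<sigma> by (intro mult_mono) auto
  then have "\<bar>(s - \<sigma> - t0) * (V (x - \<sigma> *\<^sub>R a) - V x)\<bar> \<le> (t1 - t0) * lV * M * \<sigma>"
    by (simp add: abs_mult mult.assoc mult.commute[of M])
  then show ?thesis
    by (simp only: right_diff_distrib)
qed

text \<open>The profile with negative rate is a strict subsolution. Given a quadratic upper bound with gradient \<open>p\<close>
  at \<open>(x, s)\<close>, the semigroup inequality with the control \<open>G p\<close> bounds the profile from below at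
  \<open>(x - \<sigma> G p, s - \<sigma>)\<close>; as \<open>\<sigma>\<close> tends to \<open>0\<close> this becomes \<open>m + p \<bullet> G p - L (G p) \<le> V x - \<kappa>\<close>, and
  \<open>p \<bullet> G p - L (G p)\<close> is at least \<open>H0 p\<close>. The gradients that occur are bounded by twice the spatial Lipschitz constant of
  the profile, hence the controls by \<open>M\<close>.\<close>

lemma step_lower_bound:
  assumes t: "0 \<le> t0" "t0 < t1" "t1 \<le> T"
    and f_periodic: "Zd_periodic f" and f: "l-lipschitz_on UNIV f"
    and v: "viscosity_solution (\<lambda>x p. H0 p - V x) T g v"
    and M: "\<And>p. norm p \<le> 2 * (l + (t1 - t0) * lV) \<Longrightarrow> norm (G p) \<le> M"
    and init: "\<And>x. f x - e \<le> v x t0"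
  shows "hopf_lax L (t1 - t0) f x + (t1 - t0) * V x - (t1 - t0) * (lV * M + 1) * (t1 - t0) - e
    \<le> v x t1"
proof -
  define k where "k = - ((t1 - t0) * (lV * M + 1))"
  define P where "P = l + (t1 - t0) * lV"
  define z where "z = splitting_profile L V f t0 k (- e)"
  obtain Q where Q: "Q \<ge> 0"
    "\<And>x s r. \<lbrakk>s \<in> {t0..t1}; r \<in> {t0..t1}\<rbrakk> \<Longrightarrow> \<bar>z x s - z x r\<bar> \<le> Q * \<bar>s - r\<bar>"
    unfolding z_def by (rule profile_time_lipschitz[OF f]) blast
  have l: "0 \<le> l"
    using f by (rule lipschitz_on_nonneg)
  have P: "P \<ge> 0"
    using l lV_nonneg t by (simp add: P_def)
  have "z x t1 \<le> v x t1"
  proof (rule comparison_on_slab[where T = T and F = "\<lambda>x p. H0 p - V x" and \<kappa> = "t1 - t0"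
        and P = P and Q = Q and l = lV and z = z and v = v and ?t0.0 = t0 and ?t1.0 = t1])
    show "Zd_periodic (\<lambda>x. z x s)" for s
      unfolding z_def by (rule profile_periodic[OF f_periodic])
    show "Zd_periodic (\<lambda>x. v x s)" if "s \<in> {t0..t1}" for s
      using v that t by (simp add: viscosity_solution_def)
    show "continuous_on (UNIV \<times> {t0..t1}) (\<lambda>(x, s). v x s)"
      using v t unfolding viscosity_solution_def by (auto elim!: continuous_on_subset)
    show "viscosity_supersolution (\<lambda>x p. H0 p - V x) T v"
      using v by (simp add: viscosity_solution_def)
    show "\<bar>z x s - z y s\<bar> \<le> P * norm (x - y)" if "s \<in> {t0..t1}" for x y s
      unfolding z_def P_def by (rule profile_space_lipschitz[OF f that])
    show "\<bar>(H0 p - V x) - (H0 p - V y)\<bar> \<le> lV * norm (x - y)" for x y p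
      using lipschitz_abs_diff_le[OF V_lipschitz, of x y] by (simp add: abs_minus_commute)
    show "z x t0 \<le> v x t0" for x
      using init[of x] by (simp add: z_def splitting_profile_def hopf_lax_zero)
    fix x s p m
    assume s: "s \<in> {t0<..t1}" and p: "norm p \<le> 2 * P" and jet: "past_superjet z t0 x s p m"
    obtain \<rho> c where \<rho>: "\<rho> > 0"
      and jet: "\<And>y r. \<lbrakk>norm (y - x) < \<rho>; r \<in> {t0..s}\<rbrakk> \<Longrightarrow>
        z y r \<le> z x s + p \<bullet> (y - x) + m * (r - s) + c * ((norm (y - x))\<^sup>2 + (r - s)\<^sup>2)"
      using jet unfolding past_superjet_def by blast
    define a where "a = G p"
    have a: "norm a \<le> M"
      using M p by (simp add: a_def P_def)
    then have M0: "0 \<le> M"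
      using norm_ge_zero[of a] by linarith
    have "m + p \<bullet> a - L a - V x + (t1 - t0) \<le> 0"
    proof (rule nonpos_if_le_multiple_of_small)
      show "min (s - t0) (\<rho> / (M + 1)) > 0"
        using s \<rho> M0 by simp
      fix \<sigma> assume \<sigma>: "0 < \<sigma>" "\<sigma> \<le> min (s - t0) (\<rho> / (M + 1))"
      have "norm (\<sigma> *\<^sub>R a) < \<sigma> * (M + 1)"
        using \<sigma> a by simp
      also have "\<dots> \<le> \<rho>"
        using \<sigma> M0 by (simp add: field_simps)
      finally have "z (x - \<sigma> *\<^sub>R a) (s - \<sigma>) \<le> z x s + p \<bullet> (- (\<sigma> *\<^sub>R a)) + m * (- \<sigma>)
          + c * ((norm (\<sigma> *\<^sub>R a))\<^sup>2 + \<sigma>\<^sup>2)"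
        using jet[of "x - \<sigma> *\<^sub>R a" "s - \<sigma>"] \<sigma> by simp
      moreover have "hopf_lax L (s - t0) f x \<le> hopf_lax L (s - \<sigma> - t0) f (x - \<sigma> *\<^sub>R a) + \<sigma> * L a"
        using hopf_lax_semigroup_le[OF f, of \<sigma> "s - t0" x a] \<sigma> by (simp add: algebra_simps)
      moreover have "\<bar>(s - \<sigma> - t0) * V (x - \<sigma> *\<^sub>R a) - (s - \<sigma> - t0) * V x\<bar>
          \<le> (t1 - t0) * lV * M * \<sigma>"
        using s \<sigma> a by (intro potential_along_control) auto
      ultimately have "(s - \<sigma> - t0) * V x + k * (s - \<sigma> - t0) - (t1 - t0) * lV * M * \<sigma> - \<sigma> * L a
          + (p \<bullet> (\<sigma> *\<^sub>R a) + m * \<sigma> - c * ((norm (\<sigma> *\<^sub>R a))\<^sup>2 + \<sigma>\<^sup>2))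
          \<le> (s - t0) * V x + k * (s - t0)"
        unfolding z_def splitting_profile_def inner_minus_right by linarith
      then have "\<sigma> * (m + p \<bullet> a - L a - V x + (t1 - t0)) \<le> \<sigma> * (c * ((norm a)\<^sup>2 + 1) * \<sigma>)"
        using \<sigma> by (simp add: k_def power_mult_distrib power2_eq_square algebra_simps)
      then show "m + p \<bullet> a - L a - V x + (t1 - t0) \<le> c * ((norm a)\<^sup>2 + 1) * \<sigma>"
        using \<sigma> by simp
    qed
    moreover have "H0 p \<le> p \<bullet> a - L a"
      using fenchel_equality[of p] by (simp add: a_def inner_commute)
    ultimately show "m + (H0 p - V x) \<le> - (t1 - t0)"
      by linarith
  qed (use t P Q lV_nonneg in auto)
  then show ?thesis
    by (simp add: z_def splitting_profile_def k_def)
qed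

text \<open>The mirror image of the lower bound. Instead of the control prescribed by the gradient, a nearly
  optimal one in the Hopf--Lax formula is followed backwards, and the Fenchel--Young inequality replaces the
  equality. The accuracy \<open>\<sigma>\<^sup>2\<close> is chosen so that it disappears after division by \<open>\<sigma>\<close>.\<close>

lemma step_upper_bound:
  assumes t: "0 \<le> t0" "t0 < t1" "t1 \<le> T"
    and f_periodic: "Zd_periodic f" and f: "l-lipschitz_on UNIV f"
    and v: "viscosity_solution (\<lambda>x p. H0 p - V x) T g v"
    and C: "\<And>a. (l + 1) * norm a - C \<le> L a" and M: "L 0 + C + 1 \<le> M"
    and init: "\<And>x. v x t0 \<le> f x + e"
  shows "v x t1
    \<le> hopf_lax L (t1 - t0) f x + (t1 - t0) * V x + (t1 - t0) * (lV * M + 1) * (t1 - t0) + e"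
proof -
  define k where "k = (t1 - t0) * (lV * M + 1)"
  define P where "P = l + (t1 - t0) * lV"
  define z where "z = splitting_profile L V f t0 k e"
  obtain Q where Q: "Q \<ge> 0"
    "\<And>x s r. \<lbrakk>s \<in> {t0..t1}; r \<in> {t0..t1}\<rbrakk> \<Longrightarrow> \<bar>z x s - z x r\<bar> \<le> Q * \<bar>s - r\<bar>"
    unfolding z_def by (rule profile_time_lipschitz[OF f]) blast
  have l: "0 \<le> l"
    using f by (rule lipschitz_on_nonneg)
  have P: "P \<ge> 0"
    using l lV_nonneg t by (simp add: P_def)
  have M0: "0 \<le> M"
    using C[of 0] M by simp
  have "- z x t1 \<le> - v x t1"
  proof (rule comparison_on_slab[where T = T and F = "\<lambda>x p. - (H0 (- p) - V x)" and \<kappa> = "t1 - t0"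
        and P = P and Q = Q and l = lV and z = "\<lambda>x s. - z x s" and v = "\<lambda>x s. - v x s"
        and ?t0.0 = t0 and ?t1.0 = t1])
    show "Zd_periodic (\<lambda>x. - z x s)" for s
      using profile_periodic[OF f_periodic] unfolding z_def Zd_periodic_def by simp
    show "Zd_periodic (\<lambda>x. - v x s)" if "s \<in> {t0..t1}" for s
      using v that t by (simp add: viscosity_solution_def Zd_periodic_def)
    have "continuous_on (UNIV \<times> {t0..t1}) (\<lambda>(x, s). v x s)"
      using v t unfolding viscosity_solution_def by (auto elim!: continuous_on_subset)
    then show "continuous_on (UNIV \<times> {t0..t1}) (\<lambda>(x, s). - v x s)"
      unfolding case_prod_beta' by (rule continuous_on_minus)
    show "viscosity_supersolution (\<lambda>x p. - (H0 (- p) - V x)) T (\<lambda>x s. - v x s)"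
      using v viscosity_subsolution_uminus[of "\<lambda>x p. H0 p - V x" T v]
      by (simp add: viscosity_solution_def)
    show "\<bar>- z x s - - z y s\<bar> \<le> P * norm (x - y)" if "s \<in> {t0..t1}" for x y s
      using profile_space_lipschitz[OF f that, of k e x y]
      unfolding z_def P_def by (simp add: abs_minus_commute)
    show "\<bar>- z x s - - z x r\<bar> \<le> Q * \<bar>s - r\<bar>" if "s \<in> {t0..t1}" "r \<in> {t0..t1}" for x s r
      using Q(2)[OF that, of x] by (simp add: abs_minus_commute)
    show "\<bar>- (H0 (- p) - V x) - - (H0 (- p) - V y)\<bar> \<le> lV * norm (x - y)" for x y p
      using lipschitz_abs_diff_le[OF V_lipschitz, of x y] by simp
    show "- z x t0 \<le> - v x t0" for x
      using init[of x] by (simp add: z_def splitting_profile_def hopf_lax_zero)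
    fix x s p m
    assume s: "s \<in> {t0<..t1}" and jet: "past_superjet (\<lambda>x s. - z x s) t0 x s p m"
    obtain \<rho> c where \<rho>: "\<rho> > 0"
      and jet: "\<And>y r. \<lbrakk>norm (y - x) < \<rho>; r \<in> {t0..s}\<rbrakk> \<Longrightarrow>
        - z y r \<le> - z x s + p \<bullet> (y - x) + m * (r - s) + c * ((norm (y - x))\<^sup>2 + (r - s)\<^sup>2)"
      using jet unfolding past_superjet_def by blast
    have "m - H0 (- p) + V x + (t1 - t0) \<le> 0"
    proof (rule nonpos_if_le_multiple_of_small)
      show "min (min 1 (s - t0)) (\<rho> / (M + 1)) > 0"
        using s \<rho> M0 by simp
      fix \<sigma> assume \<sigma>: "0 < \<sigma>" "\<sigma> \<le> min (min 1 (s - t0)) (\<rho> / (M + 1))"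
      have \<sigma>2: "\<sigma>\<^sup>2 \<le> s - t0"
        using \<sigma> mult_left_le[of \<sigma> \<sigma>] unfolding power2_eq_square by linarith
      obtain a where "norm a \<le> L 0 + C + 1"
        and opt: "f (x - (s - t0) *\<^sub>R a) + (s - t0) * L a \<le> hopf_lax L (s - t0) f x + \<sigma>\<^sup>2"
        by (rule hopf_lax_near_optimal[OF f C, of "\<sigma>\<^sup>2" "s - t0" x]) (use \<sigma> \<sigma>2 in auto)
      then have a: "norm a \<le> M"
        using M by simp
      have "norm (\<sigma> *\<^sub>R a) < \<sigma> * (M + 1)"
        using \<sigma> a by simp
      also have "\<dots> \<le> \<rho>"
        using \<sigma> M0 by (simp add: field_simps)
      finally have "- z (x - \<sigma> *\<^sub>R a) (s - \<sigma>) \<le> - z x s + p \<bullet> (- (\<sigma> *\<^sub>R a)) + m * (- \<sigma>)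
          + c * ((norm (\<sigma> *\<^sub>R a))\<^sup>2 + \<sigma>\<^sup>2)"
        using jet[of "x - \<sigma> *\<^sub>R a" "s - \<sigma>"] \<sigma> by simp
      also have "\<dots> \<le> - z x s + p \<bullet> (- (\<sigma> *\<^sub>R a)) + m * (- \<sigma>) + \<bar>c\<bar> * (M\<^sup>2 + 1) * \<sigma>\<^sup>2"
      proof -
        have "(norm (\<sigma> *\<^sub>R a))\<^sup>2 + \<sigma>\<^sup>2 = ((norm a)\<^sup>2 + 1) * \<sigma>\<^sup>2"
          by (simp add: power_mult_distrib algebra_simps)
        also have "\<dots> \<le> (M\<^sup>2 + 1) * \<sigma>\<^sup>2"
          using a by (intro mult_right_mono) (auto intro: power_mono)
        finally have "\<bar>c\<bar> * ((norm (\<sigma> *\<^sub>R a))\<^sup>2 + \<sigma>\<^sup>2) \<le> \<bar>c\<bar> * ((M\<^sup>2 + 1) * \<sigma>\<^sup>2)"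
          by (rule mult_left_mono) simp
        moreover have "c * ((norm (\<sigma> *\<^sub>R a))\<^sup>2 + \<sigma>\<^sup>2) \<le> \<bar>c\<bar> * ((norm (\<sigma> *\<^sub>R a))\<^sup>2 + \<sigma>\<^sup>2)"
          by (rule mult_right_mono) auto
        ultimately show ?thesis
          by (simp add: mult.assoc)
      qed
      finally have jet_at: "- z (x - \<sigma> *\<^sub>R a) (s - \<sigma>)
          \<le> - z x s + p \<bullet> (- (\<sigma> *\<^sub>R a)) + m * (- \<sigma>) + \<bar>c\<bar> * (M\<^sup>2 + 1) * \<sigma>\<^sup>2" .
      have "hopf_lax L (s - \<sigma> - t0) f (x - \<sigma> *\<^sub>R a)
          \<le> f (x - \<sigma> *\<^sub>R a - (s - \<sigma> - t0) *\<^sub>R a) + (s - \<sigma> - t0) * L a"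
        using \<sigma> by (intro hopf_lax_le[OF f]) simp
      moreover have "x - \<sigma> *\<^sub>R a - (s - \<sigma> - t0) *\<^sub>R a = x - (s - t0) *\<^sub>R a"
        by (simp add: algebra_simps)
      ultimately have "hopf_lax L (s - \<sigma> - t0) f (x - \<sigma> *\<^sub>R a)
          \<le> hopf_lax L (s - t0) f x + \<sigma>\<^sup>2 - \<sigma> * L a"
        using opt by (simp add: algebra_simps)
      moreover have "\<bar>(s - \<sigma> - t0) * V (x - \<sigma> *\<^sub>R a) - (s - \<sigma> - t0) * V x\<bar>
          \<le> (t1 - t0) * lV * M * \<sigma>"
        using s \<sigma> a by (intro potential_along_control) auto
      ultimately have "(s - t0) * V x + k * (s - t0)
          + (p \<bullet> (\<sigma> *\<^sub>R a) + m * \<sigma> - \<bar>c\<bar> * (M\<^sup>2 + 1) * \<sigma>\<^sup>2)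
          \<le> \<sigma>\<^sup>2 - \<sigma> * L a + (s - \<sigma> - t0) * V x + k * (s - \<sigma> - t0) + (t1 - t0) * lV * M * \<sigma>"
        using jet_at unfolding z_def splitting_profile_def inner_minus_right by linarith
      then have "\<sigma> * (m + p \<bullet> a + L a + V x + (t1 - t0)) \<le> \<sigma> * ((1 + \<bar>c\<bar> * (M\<^sup>2 + 1)) * \<sigma>)"
        by (simp add: k_def algebra_simps power2_eq_square)
      then have "m + p \<bullet> a + L a + V x + (t1 - t0) \<le> (1 + \<bar>c\<bar> * (M\<^sup>2 + 1)) * \<sigma>"
        using \<sigma> by simp
      moreover have "- H0 (- p) \<le> p \<bullet> a + L a"
        using fenchel_young[of a "- p"] by (simp add: inner_commute)
      ultimately show "m - H0 (- p) + V x + (t1 - t0) \<le> (1 + \<bar>c\<bar> * (M\<^sup>2 + 1)) * \<sigma>"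
        by linarith
    qed
    then show "m + - (H0 (- p) - V x) \<le> - (t1 - t0)"
      by linarith
  qed (use t P Q lV_nonneg in auto)
  then show ?thesis
    by (simp add: z_def splitting_profile_def k_def)
qed

end

section \<open>The Legendre transform\<close>

lemma superlinear_growth_bound:
  fixes f :: "real ^ 'd \<Rightarrow> real"
  assumes "superlinear f" and cont: "continuous_on UNIV f"
  shows "\<exists>C. \<forall>p. R * norm p - C \<le> f p"
proof -
  have "\<forall>\<^sub>F p in at_infinity. R \<le> f p / norm p"
    using assms(1) by (simp add: superlinear_def filterlim_at_top)
  then obtain b where b: "\<And>p. b \<le> norm p \<Longrightarrow> R \<le> f p / norm p"
    unfolding eventually_at_infinity by blast
  have "compact (f ` cball 0 \<bar>b\<bar>)"
    by (intro compact_continuous_image continuous_on_subset[OF cont]) auto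
  then obtain B where B: "\<forall>y \<in> f ` cball 0 \<bar>b\<bar>. norm y \<le> B"
    using compact_imp_bounded bounded_pos by blast
  have "0 \<le> B"
    using B by (metis centre_in_cball abs_ge_zero image_eqI norm_ge_zero order_trans)
  have "R * norm p - (\<bar>R\<bar> * \<bar>b\<bar> + B) \<le> f p" for p
  proof (cases "norm p \<le> \<bar>b\<bar>")
    case True
    then have "- B \<le> f p"
      using B by (force simp: abs_le_iff)
    moreover have "R * norm p \<le> \<bar>R\<bar> * \<bar>b\<bar>"
      using True by (intro mult_mono) auto
    ultimately show ?thesis
      by simp
  next
    case False
    then have "norm p > 0" "b \<le> norm p"
      by linarith+
    then have "R * norm p \<le> f p"
      using b[of p] by (simp add: field_simps)
    moreover have "0 \<le> \<bar>R\<bar> * \<bar>b\<bar>"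
      by simp
    ultimately show ?thesis
      using \<open>0 \<le> B\<close> by linarith
  qed
  then show ?thesis
    by blast
qed

lemma legendre_fenchel_young:
  fixes f :: "real ^ 'd \<Rightarrow> real"
  assumes "superlinear f" and "continuous_on UNIV f"
  shows "a \<bullet> p - f p \<le> legendre f a"
proof -
  obtain C where C: "\<And>p. norm a * norm p - C \<le> f p"
    using superlinear_growth_bound[OF assms] by blast
  have "a \<bullet> q - f q \<le> C" for q
    using C[of q] norm_cauchy_schwarz[of a q] by linarith
  then have "bdd_above (range (\<lambda>q. a \<bullet> q - f q))"
    by (intro bdd_aboveI2)
  then show ?thesis
    unfolding legendre_def by (rule cSUP_upper[rotated]) simp
qed

lemma legendre_least:
  assumes "\<And>p. a \<bullet> p - f p \<le> c"
  shows "legendre f a \<le> c"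
  unfolding legendre_def using assms by (intro cSUP_least) auto

text \<open>A supremum of affine functions is convex; testing with the slope \<open>p = R a / |a|\<close> gives growth of order
  \<open>R |a|\<close> up to the maximum of \<open>f\<close> on a ball.\<close>

lemma convex_lagrangian_legendre:
  fixes f :: "real ^ 'd \<Rightarrow> real"
  assumes sup: "superlinear f" and cont: "continuous_on UNIV f"
  shows "convex_lagrangian (legendre f)"
proof
  note fenchel_young = legendre_fenchel_young[OF assms]
  show "convex_on UNIV (legendre f)"
  proof (rule convex_onI)
    fix t :: real and a b :: "real ^ 'd" assume t: "0 < t" "t < 1"
    show "legendre f ((1 - t) *\<^sub>R a + t *\<^sub>R b) \<le> (1 - t) * legendre f a + t * legendre f b"
    proof (rule legendre_least)
      fix p
      have "((1 - t) *\<^sub>R a + t *\<^sub>R b) \<bullet> p - f p = (1 - t) * (a \<bullet> p - f p) + t * (b \<bullet> p - f p)"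
        by (simp add: inner_add_left algebra_simps)
      also have "\<dots> \<le> (1 - t) * legendre f a + t * legendre f b"
        using t by (intro add_mono mult_left_mono fenchel_young) auto
      finally show "((1 - t) *\<^sub>R a + t *\<^sub>R b) \<bullet> p - f p
          \<le> (1 - t) * legendre f a + t * legendre f b" .
    qed
  qed simp
  fix R :: real
  have "compact (f ` cball 0 \<bar>R\<bar>)"
    by (intro compact_continuous_image continuous_on_subset[OF cont]) auto
  then obtain C where C: "\<forall>y \<in> f ` cball 0 \<bar>R\<bar>. norm y \<le> C"
    using compact_imp_bounded bounded_pos by blast
  have "R * norm a - C \<le> legendre f a" for a
  proof -
    define p where "p = (R / norm a) *\<^sub>R a"
    have "norm p \<le> \<bar>R\<bar>"
      by (simp add: p_def)
    then have "f p \<le> C"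
      using C by (force simp: abs_le_iff)
    moreover have "a \<bullet> p = R * norm a"
      by (simp add: p_def power2_eq_square flip: power2_norm_eq_inner)
    ultimately show ?thesis
      using fenchel_young[of a p] by linarith
  qed
  then show "\<exists>C. \<forall>a. R * norm a - C \<le> legendre f a"
    by blast
qed

lemma convex_above_tangent_plane:
  fixes f :: "real ^ 'd \<Rightarrow> real"
  assumes f: "convex_on UNIV f" and D: "(f has_derivative (\<lambda>h. G \<bullet> h)) (at p)"
  shows "f p + G \<bullet> (q - p) \<le> f q"
proof -
  define h where "h t = f (p + t *\<^sub>R (q - p))" for t :: real
  have "convex_on UNIV h"
  proof (rule convex_onI)
    fix t a b :: real assume t: "0 < t" "t < 1"
    have eq: "p + ((1 - t) *\<^sub>R a + t *\<^sub>R b) *\<^sub>R (q - p)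
        = (1 - t) *\<^sub>R (p + a *\<^sub>R (q - p)) + t *\<^sub>R (p + b *\<^sub>R (q - p))"
      by (simp add: algebra_simps)
    show "h ((1 - t) *\<^sub>R a + t *\<^sub>R b) \<le> (1 - t) * h a + t * h b"
      unfolding h_def eq using t by (intro convex_onD[OF f]) auto
  qed simp
  moreover have "(h has_real_derivative (G \<bullet> (q - p))) (at 0)"
  proof -
    have "(f has_derivative (\<lambda>h. G \<bullet> h)) (at (p + 0 *\<^sub>R (q - p)))"
      using D by simp
    moreover have "((\<lambda>t. p + t *\<^sub>R (q - p)) has_derivative (\<lambda>t. t *\<^sub>R (q - p))) (at 0)"
      by (auto intro!: derivative_eq_intros)
    ultimately have "(h has_derivative (\<lambda>t. G \<bullet> (t *\<^sub>R (q - p)))) (at 0)"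
      unfolding h_def by (rule has_derivative_compose[rotated])
    then show ?thesis
      by (simp add: has_field_derivative_def mult_commute_abs)
  qed
  ultimately have "G \<bullet> (q - p) * (1 - 0) \<le> h 1 - h 0"
    by (intro convex_on_imp_above_tangent[where A = UNIV]) auto
  then show ?thesis
    by (simp add: h_def)
qed

lemma torus_L1_norm_le_sup:
  fixes f :: "real ^ 'd \<Rightarrow> real"
  assumes "\<And>x. \<bar>f x\<bar> \<le> c"
  shows "torus_L1_norm f \<le> ennreal c"
proof -
  have "torus_L1_norm f \<le> (\<integral>\<^sup>+ x. ennreal c * indicator (cbox 0 (1 :: real ^ 'd)) x \<partial>lborel)"
    unfolding torus_L1_norm_def
    by (intro nn_integral_mono mult_right_mono ennreal_leI assms) auto
  also have "\<dots> = ennreal c * emeasure lborel (cbox 0 (1 :: real ^ 'd))"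
    by (simp add: nn_integral_cmult_indicator)
  also have "emeasure lborel (cbox 0 (1 :: real ^ 'd)) = 1"
  proof -
    have "(1 :: real ^ 'd) \<bullet> b = 1" if "b \<in> Basis" for b
      using that by (auto simp: Basis_vec_def inner_axis)
    then show ?thesis
      by (simp add: emeasure_lborel_cbox_eq)
  qed
  finally show ?thesis
    by simp
qed

section \<open>The convergence rate\<close>

text \<open>Each step adds \<open>dt Lip(V)\<close> to the Lipschitz constant of the scheme and the local error to the global
  one. After at most \<open>T / dt\<close> steps the Lipschitz constant is still below \<open>lg + T * lV\<close>, so the same \<open>M\<close>
  serves for all steps.\<close>

lemma (in separable_hamiltonian) semi_lagrangian_sup_norm_error:
  assumes T: "T > 0" and g: "Zd_periodic g" "lg-lipschitz_on UNIV g"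
    and grad: "\<And>p. norm p \<le> 2 * (lg + 2 * T * lV) \<Longrightarrow> norm (G p) \<le> M"
    and C: "\<And>a. (lg + T * lV + 1) * norm a - C \<le> L a" and M: "L 0 + C + 1 \<le> M"
    and v: "viscosity_solution (\<lambda>x p. H0 p - V x) T g v"
    and dt: "dt > 0" "real N * dt = T"
    and w0: "\<And>x. w N x = g x"
    and w: "\<And>n x. n < N \<Longrightarrow> w n x = (INF a. w (Suc n) (x - dt *\<^sub>R a) + dt * (L a + V x))"
    and k: "k \<le> N"
  shows "\<bar>w (N - k) x - v x (real k * dt)\<bar> \<le> real k * (dt * (lV * M + 1) * dt)"
proof -
  have "Zd_periodic (w (N - k)) \<and> (lg + real k * dt * lV)-lipschitz_on UNIV (w (N - k)) \<and>
    (\<forall>x. \<bar>w (N - k) x - v x (real k * dt)\<bar> \<le> real k * (dt * (lV * M + 1) * dt))"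
    using k
  proof (induction k)
    case 0
    have "w N = g"
      using w0 by auto
    then show ?case
      using g v by (simp add: viscosity_solution_def)
  next
    case (Suc k)
    define f where "f = w (N - k)"
    define e where "e = real k * (dt * (lV * M + 1) * dt)"
    define t0 where "t0 = real k * dt"
    define t1 where "t1 = real (Suc k) * dt"
    have f: "Zd_periodic f" "(lg + real k * dt * lV)-lipschitz_on UNIV f"
      and err: "\<And>x. \<bar>f x - v x t0\<bar> \<le> e"
      using Suc by (auto simp: f_def e_def t0_def)
    have t: "0 \<le> t0" "t0 < t1" "t1 \<le> T"
      using dt Suc.prems by (auto simp: t0_def t1_def mult_right_mono simp flip: dt(2))
    have t10: "t1 - t0 = dt"
      by (simp add: t0_def t1_def algebra_simps)
    have kdt: "t0 + dt \<le> T"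
      using t t10 by simp
    have l_le: "lg + real k * dt * lV \<le> lg + T * lV"
      using mult_right_mono[OF _ lV_nonneg, of t0 T] kdt dt by (simp add: t0_def)
    have f': "(lg + T * lV)-lipschitz_on UNIV f"
      using f(2) l_le by (rule lipschitz_on_le)
    \<comment> \<open>The profile has the Lipschitz constant \<open>lg + T * lV + dt * lV\<close>, which is why the hypothesis on
      \<open>G\<close> mentions \<open>2 * T\<close>.\<close>
    have dtT: "dt * lV \<le> T * lV"
      using kdt t dt lV_nonneg by (intro mult_right_mono) auto
    have step: "w (N - Suc k) x = hopf_lax L dt f x + dt * V x" for x
    proof -
      have "Suc (N - Suc k) = N - k"
        using Suc.prems by simp
      then show ?thesis
        using w[of "N - Suc k" x] hopf_lax_add_potential[OF f', of dt x "V x"] Suc.prems dt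
        by (simp add: f_def)
    qed
    have "Zd_periodic (w (N - Suc k))"
      using hopf_lax_periodic[OF f(1)] V_periodic by (simp add: Zd_periodic_def step)
    moreover have "(lg + real (Suc k) * dt * lV)-lipschitz_on UNIV (w (N - Suc k))"
    proof -
      have "((lg + real k * dt * lV) + dt * lV)-lipschitz_on UNIV (\<lambda>x. hopf_lax L dt f x + dt * V x)"
        using dt V_lipschitz f(2)
        by (intro lipschitz_on_add hopf_lax_lipschitz lipschitz_on_cmult_real_upper) auto
      moreover have "w (N - Suc k) = (\<lambda>x. hopf_lax L dt f x + dt * V x)"
        using step by auto
      ultimately show ?thesis
        by (simp add: algebra_simps)
    qed
    moreover have "\<bar>w (N - Suc k) x - v x t1\<bar> \<le> dt * (lV * M + 1) * dt + e" for x
    proof -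
      have "hopf_lax L (t1 - t0) f x + (t1 - t0) * V x - (t1 - t0) * (lV * M + 1) * (t1 - t0) - e
          \<le> v x t1"
      proof (rule step_lower_bound[OF t f(1) f' v])
        show "norm (G p) \<le> M" if "norm p \<le> 2 * (lg + T * lV + (t1 - t0) * lV)" for p
          using that dtT t10 by (intro grad) simp
        show "f x - e \<le> v x t0" for x
          using err[of x] by (simp add: abs_le_iff)
      qed
      moreover have "v x t1 \<le> hopf_lax L (t1 - t0) f x + (t1 - t0) * V x
          + (t1 - t0) * (lV * M + 1) * (t1 - t0) + e"
      proof (rule step_upper_bound[OF t f(1) f' v C M])
        show "v x t0 \<le> f x + e" for x
          using err[of x] by (simp add: abs_le_iff)
      qed
      ultimately show ?thesis
        unfolding t10 step by (simp add: abs_le_iff)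
    qed
    ultimately show ?case
      by (simp add: e_def t1_def algebra_simps)
  qed
  then show ?thesis
    by blast
qed

theorem theorem3p5:
  fixes H0 V g :: "real ^ 'd \<Rightarrow> real" and T :: real
  assumes "T > 0"
    and "C2_function H0" and "convex_on UNIV H0" and "coercive H0" and "superlinear H0"
    and "Zd_periodic V" and "\<exists>K. K-lipschitz_on UNIV V" and "semiconcave V"
    and "Zd_periodic g" and "\<exists>K. K-lipschitz_on UNIV g" and "semiconcave g"
  shows "\<exists>C>0. \<forall>u. backward_viscosity_solution (\<lambda>x p. H0 p - V x) T g u \<longrightarrow>
    (\<forall>dt>0. \<forall>N>0. real N = T / dt \<longrightarrow>
      (\<forall>w. semi_lagrangian_solution H0 V g dt N w \<longrightarrow>
        (SUP n\<in>{0..N}. torus_L1_norm (\<lambda>x. w n x - u x (real n * dt))) \<le> ennreal (C * dt)))"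
proof -
  obtain G :: "real ^ 'd \<Rightarrow> real ^ 'd" and A :: "real ^ 'd \<Rightarrow> real ^ 'd ^ 'd"
    where G: "\<And>x. (H0 has_derivative (\<lambda>h. G x \<bullet> h)) (at x)"
      and A: "\<And>x. (G has_derivative (\<lambda>h. A x *v h)) (at x)"
    using assms(2) unfolding C2_function_def by blast
  have H0_cont: "continuous_on UNIV H0"
    using G by (auto intro!: continuous_at_imp_continuous_on has_derivative_continuous)
  have G_cont: "continuous_on UNIV G"
    using A by (auto intro!: continuous_at_imp_continuous_on has_derivative_continuous)
  obtain lV lg where lV: "lV-lipschitz_on UNIV V" and lg: "lg-lipschitz_on UNIV g"
    using assms(7,10) by blast
  interpret convex_lagrangian "legendre H0"
    using assms(5) H0_cont by (rule convex_lagrangian_legendre)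
  interpret separable_hamiltonian "legendre H0" H0 V G lV
  proof
    show "a \<bullet> p - H0 p \<le> legendre H0 a" for a p
      using assms(5) H0_cont by (rule legendre_fenchel_young)
    show "legendre H0 (G p) \<le> G p \<bullet> p - H0 p" for p
    proof (rule legendre_least)
      show "G p \<bullet> q - H0 q \<le> G p \<bullet> p - H0 p" for q
        using convex_above_tangent_plane[OF assms(3) G, of p q] by (simp add: inner_diff_right)
    qed
  qed (use assms(6) lV in auto)
  obtain C0 where C0: "\<And>a. (lg + T * lV + 1) * norm a - C0 \<le> legendre H0 a"
    using superlinear_growth by blast
  have "compact (G ` cball 0 (2 * (lg + 2 * T * lV)))"
    by (intro compact_continuous_image continuous_on_subset[OF G_cont]) auto
  then obtain B where B: "B > 0" "\<forall>y \<in> G ` cball 0 (2 * (lg + 2 * T * lV)). norm y \<le> B"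
    using compact_imp_bounded bounded_pos by blast
  define M where "M = max B (legendre H0 0 + C0 + 1)"
  have M: "M > 0" "legendre H0 0 + C0 + 1 \<le> M"
    using B(1) by (auto simp: M_def)
  have grad: "norm (G p) \<le> M" if "norm p \<le> 2 * (lg + 2 * T * lV)" for p
    using B(2) that by (force simp: M_def)
  define C where "C = T * (lV * M + 1)"
  have rate: "0 < lV * M + 1"
    using M lV_nonneg by (simp add: add_nonneg_pos)
  show ?thesis
  proof (intro exI[of _ C] conjI allI impI SUP_least torus_L1_norm_le_sup)
    show "C > 0"
      using assms(1) rate by (simp add: C_def)
    fix u dt N w n x
    assume u: "backward_viscosity_solution (\<lambda>x p. H0 p - V x) T g u"
      and dt: "dt > 0" "real N = T / dt" and w: "semi_lagrangian_solution H0 V g dt N w"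
      and n: "n \<in> {0..N}"
    have NT: "real N * dt = T"
      using dt by simp
    have time: "T - real (N - n) * dt = real n * dt"
      using n by (simp add: of_nat_diff algebra_simps flip: NT)
    have "\<bar>w (N - (N - n)) x - u x (T - real (N - n) * dt)\<bar>
        \<le> real (N - n) * (dt * (lV * M + 1) * dt)"
      using w u unfolding semi_lagrangian_solution_def backward_viscosity_solution_def
      by (intro semi_lagrangian_sup_norm_error[OF assms(1,9) lg grad C0 M(2) _ dt(1) NT]) auto
    also have "\<dots> \<le> real N * (dt * (lV * M + 1) * dt)"
      using dt rate by (intro mult_right_mono) auto
    also have "\<dots> = C * dt"
      by (simp add: C_def flip: NT)
    finally show "\<bar>w n x - u x (real n * dt)\<bar> \<le> C * dt"
      using n unfolding time by simp
  qed
qed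

end
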